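(* There exist an absolute constant $c\ge1$ and, for each $\alpha\in(0,2]$, a constant $K_\alpha>0$ depending only on $\alpha$, such that the following holds. Let $0<\alpha\le2$ and $K\ge K_\alpha$. Then there exists a constant $c'>0$ depending only on $\alpha$ and $K$ such that for all integers $n\ge2$, $p\ge1$ and $s\in[p]$ with $s\ge c$, $$\mathcal{R}_{\mathcal{G}}(\rho)\ge\frac12\quad\text{whenever}\quad\rho^2\le c'\,v_{\mathcal{G}}^{\mathrm L},$$ where $$v_{\mathcal{G}}^{\mathrm L}:=\Bigl\{s\log^{2/\alpha}(ep/s)\wedge\sqrt{p\{\log\log(8n)\}^{\omega_1}}\Bigr\}+\log\log(8n),\qquad\omega_1=\mathbf{1}\bigl\{s>\sqrt{p\log\log(8n)}\bigr\}.$$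
   Context: Notation: $[m]=\{1,\dots,m\}$; $x\wedge y=\min(x,y)$; $\log$ is the natural logarithm; $\|v\|_0$ is the number of nonzero entries of $v$. Model: $X=\theta+E\in\mathbb{R}^{p\times n}$, with deterministic $\theta$ and random $E\sim P_e$; $X_t,\theta_t,E_t\in\mathbb{R}^p$ denote the $t$-th columns. $\mathbb{E}_{\theta,P_e}$ is expectation under the law of $X$. Null space: $\Theta_0(p,n)=\{\theta:\exists\mu\in\mathbb{R}^p,\ \theta_t=\mu\ \forall t\in[n]\}$. For $t_0\in[n-1]$, $\Theta^{(t_0)}(p,n,s,\rho)$ is the set of $\theta$ for which there are $\mu_1,\mu_2\in\mathbb{R}^p$ with $\theta_t=\mu_1$ for $t\le t_0$, $\theta_t=\mu_2$ for $t>t_0$, $\|\mu_1-\mu_2\|_0\le s$ and $\frac{t_0(n-t_0)}{n}\|\mu_1-\mu_2\|_2^2\ge\rho^2$. Alternative space: $\Theta(p,n,s,\rho)=\bigcup_{t_0=1}^{n-1}\Theta^{(t_0)}(p,n,s,\rho)$. Noise class: $\mathcal{G}_{\alpha,K}$ is the class of distributions of real random variables $W$ with $\mathbb{E}W=0$, $\mathbb{E}W^2=1$, $\mathbb{E}\exp(|W/K|^\alpha)\le 2$. $\mathcal{G}_{\alpha,K}^{\otimes}$ is the class of joint distributions of $E$ with mutually independent entries, each entry having a (possibly different) distribution in $\mathcal{G}_{\alpha,K}$. Minimax testing error, with the infimum over all measurable $\phi:\mathbb{R}^{p\times n}\to\{0,1\}$: $$\mathcal{R}_{\mathcal{G}}(\rho)=\inf_\phi\Bigl\{\sup_{P_e\in\mathcal{G}_{\alpha,K}^{\otimes}}\sup_{\theta\in\Theta_0(p,n)}\mathbb{E}_{\theta,P_e}(\phi)+\sup_{P_e\in\mathcal{G}_{\alpha,K}^{\otimes}}\sup_{\theta\in\Theta(p,n,s,\rho)}\mathbb{E}_{\theta,P_e}(1-\phi)\Bigr\}.$$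 *)

theory Defs
  imports "HOL-Probability.Probability"
begin

text \<open>
  Since \<open>p\<close> and \<open>n\<close> are quantified inside the statement, a \<open>p \<times> n\<close> matrix is an extensional
  function on the index set \<open>{1..p} \<times> {1..n}\<close>; the entry in row \<open>i\<close> and column \<open>t\<close> of \<open>X\<close>
  is \<open>X (i, t)\<close>.  A vector in dimension \<open>p\<close> is a function of which only the values on
  \<open>{1..p}\<close> are ever used.
\<close>

type_synonym real_mat = "nat \<times> nat \<Rightarrow> real"

definition mat_index :: "nat \<Rightarrow> nat \<Rightarrow> (nat \<times> nat) set" where
  "mat_index p n = {1..p} \<times> {1..n}"

definition mat_borel :: "nat \<Rightarrow> nat \<Rightarrow> real_mat measure" where
  "mat_borel p n = (\<Pi>\<^sub>M ij\<in>mat_index p n. borel)"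

definition l0_norm :: "nat \<Rightarrow> (nat \<Rightarrow> real) \<Rightarrow> nat" where
  "l0_norm p v = card {i \<in> {1..p}. v i \<noteq> 0}"

definition l2_norm :: "nat \<Rightarrow> (nat \<Rightarrow> real) \<Rightarrow> real" where
  "l2_norm p v = L2_set v {1..p}"

definition Theta_null :: "nat \<Rightarrow> nat \<Rightarrow> real_mat set" where
  "Theta_null p n = {\<theta> \<in> space (mat_borel p n).
     \<exists>\<mu> :: nat \<Rightarrow> real. \<forall>t\<in>{1..n}. \<forall>i\<in>{1..p}. \<theta> (i, t) = \<mu> i}"

definition Theta_at :: "nat \<Rightarrow> nat \<Rightarrow> nat \<Rightarrow> nat \<Rightarrow> real \<Rightarrow> real_mat set" where
  "Theta_at t0 p n s \<rho> = {\<theta> \<in> space (mat_borel p n).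
     \<exists>\<mu>1 \<mu>2 :: nat \<Rightarrow> real.
       (\<forall>t\<in>{1..n}. \<forall>i\<in>{1..p}. \<theta> (i, t) = (if t \<le> t0 then \<mu>1 i else \<mu>2 i)) \<and>
       l0_norm p (\<lambda>i. \<mu>1 i - \<mu>2 i) \<le> s \<and>
       real t0 * (real n - real t0) / real n * (l2_norm p (\<lambda>i. \<mu>1 i - \<mu>2 i))\<^sup>2 \<ge> \<rho>\<^sup>2}"

definition Theta_alt :: "nat \<Rightarrow> nat \<Rightarrow> nat \<Rightarrow> real \<Rightarrow> real_mat set" where
  "Theta_alt p n s \<rho> = (\<Union>t0\<in>{1..n - 1}. Theta_at t0 p n s \<rho>)"

definition noise_class :: "real \<Rightarrow> real \<Rightarrow> real measure set" where
  "noise_class \<alpha> K = {M. prob_space M \<and> sets M = sets borel \<and>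
     integrable M (\<lambda>w. w) \<and> (\<integral>w. w \<partial>M) = 0 \<and>
     integrable M (\<lambda>w. w\<^sup>2) \<and> (\<integral>w. w\<^sup>2 \<partial>M) = 1 \<and>
     (\<integral>\<^sup>+w. ennreal (exp (\<bar>w / K\<bar> powr \<alpha>)) \<partial>M) \<le> 2}"

definition noise_class_joint :: "real \<Rightarrow> real \<Rightarrow> nat \<Rightarrow> nat \<Rightarrow> real_mat measure set" where
  "noise_class_joint \<alpha> K p n = {P. prob_space P \<and> sets P = sets (mat_borel p n) \<and>
     prob_space.indep_vars P (\<lambda>ij. borel) (\<lambda>ij E. E ij) (mat_index p n) \<and>
     (\<forall>ij\<in>mat_index p n. distr P borel (\<lambda>E. E ij) \<in> noise_class \<alpha> K)}"

definition data_law :: "nat \<Rightarrow> nat \<Rightarrow> real_mat \<Rightarrow> real_mat measure \<Rightarrow> real_mat measure" where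
  "data_law p n \<theta> P = distr P (mat_borel p n) (\<lambda>E. \<lambda>ij\<in>mat_index p n. \<theta> ij + E ij)"

definition data_expectation ::
  "nat \<Rightarrow> nat \<Rightarrow> real_mat \<Rightarrow> real_mat measure \<Rightarrow> (real_mat \<Rightarrow> real) \<Rightarrow> real" where
  "data_expectation p n \<theta> P f = (\<integral>X. f X \<partial>data_law p n \<theta> P)"

definition tests :: "nat \<Rightarrow> nat \<Rightarrow> (real_mat \<Rightarrow> real) set" where
  "tests p n = measurable (mat_borel p n) (count_space {0, 1})"

text \<open>
  The errors are nonnegative, so infimum and suprema are taken in the complete lattice
  \<^typ>\<open>ennreal\<close>, where they need no boundedness side conditions.
\<close>

definition testing_error ::
  "real \<Rightarrow> real \<Rightarrow> nat \<Rightarrow> nat \<Rightarrow> nat \<Rightarrow> real \<Rightarrow> (real_mat \<Rightarrow> real) \<Rightarrow> ennreal" where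
  "testing_error \<alpha> K p n s \<rho> \<phi> =
     (SUP P\<in>noise_class_joint \<alpha> K p n. SUP \<theta>\<in>Theta_null p n.
        ennreal (data_expectation p n \<theta> P \<phi>)) +
     (SUP P\<in>noise_class_joint \<alpha> K p n. SUP \<theta>\<in>Theta_alt p n s \<rho>.
        ennreal (data_expectation p n \<theta> P (\<lambda>X. 1 - \<phi> X)))"

definition minimax_error ::
  "real \<Rightarrow> real \<Rightarrow> nat \<Rightarrow> nat \<Rightarrow> nat \<Rightarrow> real \<Rightarrow> ennreal" where
  "minimax_error \<alpha> K p n s \<rho> = (INF \<phi>\<in>tests p n. testing_error \<alpha> K p n s \<rho> \<phi>)"

definition omega1 :: "nat \<Rightarrow> nat \<Rightarrow> nat \<Rightarrow> nat" where
  "omega1 p n s = (if real s > sqrt (real p * ln (ln (8 * real n))) then 1 else 0)"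

definition v_lower :: "real \<Rightarrow> nat \<Rightarrow> nat \<Rightarrow> nat \<Rightarrow> real" where
  "v_lower \<alpha> p n s =
     min (real s * ln (exp 1 * real p / real s) powr (2 / \<alpha>))
         (sqrt (real p * ln (ln (8 * real n)) ^ omega1 p n s))
     + ln (ln (8 * real n))"

end

theory Submission
  imports Defs
begin

text \<open>
  Lower bound by priors whose data laws all have finite support.  Since the error is a supremum over
  noise laws as well as over signals, the noise may depend on the signal: it suffices to exhibit, for
  every alternative \<open>\<theta>\<close>, entry laws with mean \<open>\<theta> ij\<close>, variance 1 and light tails whose mixture over a prior
  is close in \<open>\<chi>\<^sup>2\<close> divergence to one fixed null law.

  For the \<open>log log\<close> term and in the dense regime, the entry laws are the laws \<open>tri\<close> on \<open>{-2, 0, 2}\<close>,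
  whose likelihood ratios have correlation \<open>1 + \<mu>\<nu> + (\<mu>\<nu>)\<^sup>2/3\<close>.  The change point is uniform on
  powers of 4, of which there are at least of order \<open>log n\<close>, and two profiles with change points \<open>4^k\<close> and \<open>4^l\<close>
  have normalized overlap \<open>2^(-|k - l|)\<close>.  The chord bound \<open>e^(at) \<le> 1 + t(e^a - 1)\<close> then controls the
  \<open>\<chi>\<^sup>2\<close> divergence as long as the squared signal is a small multiple of \<open>log log n\<close> (one row), or
  of \<open>sqrt (p log log n)\<close> (random signs on about \<open>s/8\<close> random rows).

  In the remaining regime only the first column is shifted, by \<open>\<plusminus>d\<close> on about \<open>s/8\<close> random rows.  The
  null law contains the same far atoms \<open>\<plusminus>d \<plusminus> 1\<close> as the alternative mixture, with the same weight, and
  compensates their excess variance by shrinking its central part \<open>tri\<close>.  The mixtures thus differ only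
  in the second moment of the central part, which is invisible in \<open>p\<close> coordinates while \<open>s d\<^sup>2\<close>
  is at most of order \<open>sqrt p\<close>; the tail condition on the noise allows \<open>d\<close> up to \<open>log\<^bsup>1/\<alpha>\<^esup> (ep/s)\<close>.
\<close>

section \<open>Reduction to finitely supported laws\<close>

text \<open>
  \<open>noise_law \<alpha> K S \<mu> f\<close>: the weights \<open>f\<close> on the finite set \<open>S\<close> are the law of a data entry with mean \<open>\<mu>\<close>
  whose noise lies in \<^const>\<open>noise_class\<close>.  Values of \<open>f\<close> outside \<open>S\<close> are irrelevant.
\<close>

definition noise_law :: "real \<Rightarrow> real \<Rightarrow> real set \<Rightarrow> real \<Rightarrow> (real \<Rightarrow> real) \<Rightarrow> bool" where
  "noise_law \<alpha> K S \<mu> f \<longleftrightarrow> (\<forall>x\<in>S. 0 \<le> f x) \<and> (\<Sum>x\<in>S. f x) = 1 \<and>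
     (\<Sum>x\<in>S. f x * (x - \<mu>)) = 0 \<and> (\<Sum>x\<in>S. f x * (x - \<mu>)\<^sup>2) = 1 \<and>
     (\<Sum>x\<in>S. f x * exp (\<bar>(x - \<mu>) / K\<bar> powr \<alpha>)) \<le> 2"

lemma exists_pmf_finite_support:
  fixes f :: "'a \<Rightarrow> real"
  assumes "finite S" "\<And>x. x \<in> S \<Longrightarrow> 0 \<le> f x" "(\<Sum>x\<in>S. f x) = 1"
  shows "\<exists>q. (\<forall>x. pmf q x = (if x \<in> S then f x else 0))"
proof -
  have "(\<integral>\<^sup>+x. ennreal (if x \<in> S then f x else 0) \<partial>count_space UNIV) =
        (\<Sum>x\<in>S. ennreal (f x))"
    using assms(1) by (subst nn_integral_count_space'[of S]) (auto intro: sum.cong)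
  also have "\<dots> = ennreal (\<Sum>x\<in>S. f x)"
    using assms(2) by (simp add: sum_ennreal)
  finally have "pmf (embed_pmf (\<lambda>x. if x \<in> S then f x else 0)) x = (if x \<in> S then f x else 0)" for x
    using assms by (subst pmf_embed_pmf) auto
  then show ?thesis by blast
qed

lemma finite_mat_index [simp]: "finite (mat_index p n)"
  by (simp add: mat_index_def)

lemma noise_law_imp_noise_class:
  assumes S: "finite S" and f: "noise_law \<alpha> K S \<mu> f"
    and q: "\<And>x. pmf q x = (if x \<in> S then f x else 0)"
  shows "distr (measure_pmf q) borel (\<lambda>x. x - \<mu>) \<in> noise_class \<alpha> K"
proof -
  have sub: "set_pmf q \<subseteq> S"
    using q by (auto simp: set_pmf_eq split: if_splits)
  have fin: "finite (set_pmf q)"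
    using sub S by (rule finite_subset)
  have int: "(\<integral>x. g x \<partial>measure_pmf q) = (\<Sum>x\<in>S. f x * g x)" for g :: "real \<Rightarrow> real"
    using sub S q by (subst integral_measure_pmf_real[of S]) (auto intro!: sum.cong simp: mult.commute)
  have "(\<integral>\<^sup>+x. ennreal (exp (\<bar>(x - \<mu>) / K\<bar> powr \<alpha>)) \<partial>measure_pmf q) =
      ennreal (\<integral>x. exp (\<bar>(x - \<mu>) / K\<bar> powr \<alpha>) \<partial>measure_pmf q)"
    by (intro nn_integral_eq_integral integrable_measure_pmf_finite fin) auto
  also have "\<dots> \<le> ennreal 2"
    using f by (intro ennreal_leI) (simp add: int noise_law_def)
  finally have "(\<integral>\<^sup>+x. ennreal (exp (\<bar>(x - \<mu>) / K\<bar> powr \<alpha>)) \<partial>measure_pmf q) \<le> 2"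
    by simp
  then show ?thesis
    using f fin
    by (auto simp: noise_class_def noise_law_def int integral_distr integrable_distr_eq
        nn_integral_distr integrable_measure_pmf_finite
        intro!: prob_space.prob_space_distr measure_pmf.prob_space_axioms)
qed

text \<open>Any choice of admissible entry laws on a finite set is realised by one joint noise law,
  under which expectations of measurable functions of the data become finite sums. The later
  arguments therefore only handle weights on finitely many matrices.\<close>

lemma exists_joint_noise:
  fixes q :: "nat \<times> nat \<Rightarrow> real \<Rightarrow> real"
  assumes S: "finite S" and ne: "mat_index p n \<noteq> {}"
    and q: "\<And>ij. ij \<in> mat_index p n \<Longrightarrow> noise_law \<alpha> K S (\<theta> ij) (q ij)"
  shows "\<exists>P\<in>noise_class_joint \<alpha> K p n. \<forall>f\<in>borel_measurable (mat_borel p n).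
           data_expectation p n \<theta> P f =
           (\<Sum>X\<in>mat_index p n \<rightarrow>\<^sub>E S. (\<Prod>ij\<in>mat_index p n. q ij (X ij)) * f X)"
proof -
  let ?I = "mat_index p n"
  have "\<exists>r. \<forall>x. pmf r x = (if x \<in> S then q ij x else 0)" if "ij \<in> ?I" for ij
    using q[OF that] S by (intro exists_pmf_finite_support) (auto simp: noise_law_def)
  then obtain r where r: "\<And>ij x. ij \<in> ?I \<Longrightarrow> pmf (r ij) x = (if x \<in> S then q ij x else 0)"
    by metis
  \<comment> \<open>The data are drawn first, and the noise is defined as data minus
    \<open>\<theta>\<close>. The default \<open>undefined\<close> places every draw in the
    extensional function space underlying \<open>mat_borel\<close>.\<close>
  define R where "R = Pi_pmf ?I undefined r"
  define sh where "sh = (\<lambda>X. \<lambda>ij\<in>?I. X ij - \<theta> ij)"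
  have sh [measurable]: "sh \<in> measurable (measure_pmf R) (mat_borel p n)"
    by (auto simp: sh_def mat_borel_def space_PiM)
  define P where "P = distr (measure_pmf R) (mat_borel p n) sh"
  interpret P: prob_space P
    unfolding P_def by (rule measure_pmf.prob_space_distr[OF sh])
  have coord [measurable]: "(\<lambda>E. E ij) \<in> borel_measurable (mat_borel p n)" if "ij \<in> ?I" for ij
    using that unfolding mat_borel_def by measurable
  have marg: "distr P borel (\<lambda>E. E ij) = distr (measure_pmf R) borel (\<lambda>X. X ij - \<theta> ij)"
    if "ij \<in> ?I" for ij
    unfolding P_def using that coord[OF that] sh
    by (subst distr_distr) (auto simp: sh_def comp_def intro!: distr_cong)
  have marg': "distr (measure_pmf R) borel (\<lambda>X. X ij - \<theta> ij) =
      distr (measure_pmf (r ij)) borel (\<lambda>x. x - \<theta> ij)" if "ij \<in> ?I" for ij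
  proof -
    have "r ij = map_pmf (\<lambda>X. X ij) R"
      unfolding R_def using that by (subst Pi_pmf_component) auto
    then show ?thesis
      by (simp add: map_pmf_rep_eq distr_distr comp_def)
  qed
  have "prob_space.indep_vars (measure_pmf R) (\<lambda>_. borel) (\<lambda>ij X. X ij - \<theta> ij) ?I"
    using indep_vars_Pi_pmf[OF finite_mat_index, of p n undefined r, folded R_def]
    by (rule prob_space.indep_vars_compose2[OF measure_pmf.prob_space_axioms,
          where M' = "\<lambda>_. count_space UNIV" and X = "\<lambda>ij X. X ij" and Y = "\<lambda>ij x. x - \<theta> ij"]) auto
  then have "distr (measure_pmf R) (\<Pi>\<^sub>M ij\<in>?I. borel) sh =
      (\<Pi>\<^sub>M ij\<in>?I. distr (measure_pmf R) borel (\<lambda>X. X ij - \<theta> ij))"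
    unfolding sh_def using ne
    by (subst (asm) prob_space.indep_vars_iff_distr_eq_PiM[OF measure_pmf.prob_space_axioms]) auto
  then have P_eq: "P = (\<Pi>\<^sub>M ij\<in>?I. distr P borel (\<lambda>E. E ij))"
    using marg by (simp add: P_def mat_borel_def cong: PiM_cong)
  have setsP [measurable_cong]: "sets P = sets (mat_borel p n)"
    by (simp add: P_def)
  \<comment> \<open>Restriction is the identity on extensional functions, so the joint law of the
    coordinates is \<open>P\<close> itself, and its product form gives independence.\<close>
  have "distr P (\<Pi>\<^sub>M ij\<in>?I. borel) (\<lambda>E. \<lambda>ij\<in>?I. E ij) = distr P P (\<lambda>E. E)"
  proof (rule distr_cong)
    show "sets (\<Pi>\<^sub>M ij\<in>?I. borel) = sets P"
      by (simp add: setsP mat_borel_def)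
    show "(\<lambda>ij\<in>?I. E ij) = E" if "E \<in> space P" for E
      using that by (auto simp: P_def mat_borel_def space_PiM intro: PiE_restrict)
  qed simp
  then have "P.indep_vars (\<lambda>_. borel) (\<lambda>ij E. E ij) ?I"
    using ne P_eq by (subst P.indep_vars_iff_distr_eq_PiM') (auto simp: distr_id)
  moreover have "distr P borel (\<lambda>E. E ij) \<in> noise_class \<alpha> K" if "ij \<in> ?I" for ij
    using noise_law_imp_noise_class[OF S q[OF that] r[OF that]] that by (simp add: marg marg')
  ultimately have 1: "P \<in> noise_class_joint \<alpha> K p n"
    by (auto simp: noise_class_joint_def P.prob_space_axioms setsP)
  have supp: "set_pmf R \<subseteq> ?I \<rightarrow>\<^sub>E S"
  proof
    fix X assume "X \<in> set_pmf R"
    then have "X \<in> PiE_dflt ?I undefined (set_pmf \<circ> r)"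
      using set_Pi_pmf[of ?I undefined r] by (simp add: R_def)
    then show "X \<in> ?I \<rightarrow>\<^sub>E S"
      using r by (fastforce simp: PiE_dflt_def set_pmf_eq PiE_def extensional_def split: if_splits)
  qed
  have fin: "finite (?I \<rightarrow>\<^sub>E S)"
    using S by (intro finite_PiE) auto
  have 2: "data_expectation p n \<theta> P f = (\<Sum>X\<in>?I \<rightarrow>\<^sub>E S. (\<Prod>ij\<in>?I. q ij (X ij)) * f X)"
    if f [measurable]: "f \<in> borel_measurable (mat_borel p n)" for f
  proof -
    let ?g = "\<lambda>E. \<lambda>ij\<in>?I. \<theta> ij + E ij"
    have g [measurable]: "?g \<in> measurable (mat_borel p n) (mat_borel p n)"
      unfolding mat_borel_def by measurable
    have "data_expectation p n \<theta> P f = (\<integral>X. f (?g (sh X)) \<partial>measure_pmf R)"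
      unfolding data_expectation_def data_law_def
      using integral_distr[of ?g P, OF _ f] g integral_distr[OF sh measurable_compose[OF g f]]
      by (simp add: P_def)
    also have "\<dots> = (\<integral>X. f X \<partial>measure_pmf R)"
    proof (rule integral_cong_AE)
      show "AE X in measure_pmf R. f (?g (sh X)) = f X"
      proof (rule AE_pmfI)
        fix X assume "X \<in> set_pmf R"
        then have "X \<in> ?I \<rightarrow>\<^sub>E S" using supp by blast
        then have "?g (sh X) = X"
          by (auto simp: sh_def fun_eq_iff PiE_def extensional_def)
        then show "f (?g (sh X)) = f X" by simp
      qed
    qed auto
    also have "\<dots> = (\<Sum>X\<in>?I \<rightarrow>\<^sub>E S. f X * pmf R X)"
      using supp fin by (intro integral_measure_pmf_real) auto
    also have "\<dots> = (\<Sum>X\<in>?I \<rightarrow>\<^sub>E S. (\<Prod>ij\<in>?I. q ij (X ij)) * f X)"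
    proof (rule sum.cong)
      fix X assume X: "X \<in> ?I \<rightarrow>\<^sub>E S"
      then have "pmf R X = (\<Prod>ij\<in>?I. pmf (r ij) (X ij))"
        unfolding R_def by (intro pmf_Pi') (auto simp: PiE_def extensional_def)
      also have "\<dots> = (\<Prod>ij\<in>?I. q ij (X ij))"
        using X r by (intro prod.cong) auto
      finally show "f X * pmf R X = (\<Prod>ij\<in>?I. q ij (X ij)) * f X"
        by simp
    qed simp
    finally show ?thesis .
  qed
  show ?thesis using 1 2 by blast
qed

text \<open>
  A crude form of the bound \<open>1 - TV \<ge> 1 - sqrt \<chi>\<^sup>2 / 2\<close> that avoids Cauchy-Schwarz: \<open>y \<phi> \<le> y\<^sup>2 + 1/4\<close> for
  \<open>\<phi> \<in> {0, 1}\<close>, applied with \<open>y = M/F0 - 1\<close>.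
\<close>

lemma bayes_error_lower_bound:
  fixes F0 M \<phi> :: "'a \<Rightarrow> real"
  assumes F0: "\<And>x. x \<in> A \<Longrightarrow> 0 < F0 x" "(\<Sum>x\<in>A. F0 x) = 1"
    and M: "(\<Sum>x\<in>A. M x) = 1"
    and chi: "(\<Sum>x\<in>A. (M x)\<^sup>2 / F0 x) \<le> 9 / 8"
    and \<phi>: "\<And>x. x \<in> A \<Longrightarrow> \<phi> x \<in> {0, 1}"
  shows "5 / 8 \<le> (\<Sum>x\<in>A. F0 x * \<phi> x) + (\<Sum>x\<in>A. M x * (1 - \<phi> x))"
proof -
  have "(M x - F0 x) * \<phi> x \<le> (M x)\<^sup>2 / F0 x - 2 * M x + 5 / 4 * F0 x" if "x \<in> A" for x
  proof -
    have pos: "0 < F0 x" using F0 that by blast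
    have "(M x)\<^sup>2 / F0 x - 2 * M x + F0 x = (M x - F0 x)\<^sup>2 / F0 x"
      using pos by (simp add: field_simps power2_eq_square)
    moreover have "(M x - F0 x) * \<phi> x \<le> (M x - F0 x)\<^sup>2 / F0 x + F0 x / 4"
    proof (cases "\<phi> x = 0")
      case False
      have "(M x - F0 x) \<le> (M x - F0 x)\<^sup>2 / F0 x + F0 x / 4 \<longleftrightarrow>
          0 \<le> (M x - F0 x - F0 x / 2)\<^sup>2 / F0 x"
        using pos by (simp add: field_simps power2_eq_square)
      then show ?thesis using False \<phi>[OF that] pos by simp
    qed (use pos in simp)
    ultimately show ?thesis by linarith
  qed
  then have "(\<Sum>x\<in>A. (M x - F0 x) * \<phi> x) \<le> (\<Sum>x\<in>A. (M x)\<^sup>2 / F0 x - 2 * M x + 5 / 4 * F0 x)"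
    by (rule sum_mono)
  also have "\<dots> = (\<Sum>x\<in>A. (M x)\<^sup>2 / F0 x) - 2 + 5 / 4"
    using F0 M by (simp add: sum.distrib sum_subtractf flip: sum_distrib_left sum_divide_distrib)
  finally have "(\<Sum>x\<in>A. (M x - F0 x) * \<phi> x) \<le> 3 / 8"
    using chi by simp
  moreover have "(\<Sum>x\<in>A. F0 x * \<phi> x) + (\<Sum>x\<in>A. M x * (1 - \<phi> x)) =
      (\<Sum>x\<in>A. M x) - (\<Sum>x\<in>A. (M x - F0 x) * \<phi> x)"
    by (simp add: algebra_simps sum.distrib sum_subtractf)
  ultimately show ?thesis using M by simp
qed

text \<open>A Bayes argument: the supremum over alternatives dominates an average over the prior
  \<open>\<pi>\<close>, whose index \<open>w\<close> fixes the signal and the noise law together.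
  For each pair \<open>w\<close>, \<open>w'\<close> the chi-square sum factors over entries. Draws
  outside \<open>G\<close> may fail to be alternatives; they cost at most 1/8, and 5/8 - 1/8 =
  1/2.\<close>

lemma minimax_error_lower_bound:
  fixes q :: "'w \<Rightarrow> nat \<times> nat \<Rightarrow> real \<Rightarrow> real"
  assumes S: "finite S" and ne: "mat_index p n \<noteq> {}"
    and W: "finite W" "\<And>w. w \<in> W \<Longrightarrow> 0 \<le> \<pi> w" "(\<Sum>w\<in>W. \<pi> w) = 1"
    and G: "G \<subseteq> W" "(\<Sum>w\<in>W - G. \<pi> w) \<le> 1 / 8"
    and q0: "\<And>ij. ij \<in> mat_index p n \<Longrightarrow> noise_law \<alpha> K S 0 (q0 ij)"
    and q0_pos: "\<And>ij x. ij \<in> mat_index p n \<Longrightarrow> x \<in> S \<Longrightarrow> 0 < q0 ij x"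
    and q: "\<And>w ij. w \<in> W \<Longrightarrow> ij \<in> mat_index p n \<Longrightarrow> noise_law \<alpha> K S (\<theta> w ij) (q w ij)"
    and alt: "\<And>w. w \<in> G \<Longrightarrow> \<theta> w \<in> Theta_alt p n s \<rho>"
    and chi: "(\<Sum>w\<in>W. \<Sum>w'\<in>W. \<pi> w * \<pi> w' *
       (\<Prod>ij\<in>mat_index p n. \<Sum>x\<in>S. q w ij x * q w' ij x / q0 ij x)) \<le> 9 / 8"
  shows "1 / 2 \<le> minimax_error \<alpha> K p n s \<rho>"
  unfolding minimax_error_def
proof (rule INF_greatest)
  fix \<phi> assume \<phi>: "\<phi> \<in> tests p n"
  let ?I = "mat_index p n"
  let ?A = "?I \<rightarrow>\<^sub>E S"
  have \<phi>_count: "\<phi> \<in> measurable (mat_borel p n) (count_space {0, 1})"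
    using \<phi> by (simp add: tests_def)
  have \<phi>_meas [measurable]: "\<phi> \<in> borel_measurable (mat_borel p n)"
    using measurable_compose[OF \<phi>_count, of "\<lambda>x. x" borel] by simp
  have A_sub: "?A \<subseteq> space (mat_borel p n)"
    by (auto simp: mat_borel_def space_PiM PiE_def)
  have \<phi>01: "\<phi> X \<in> {0, 1}" if "X \<in> ?A" for X
    using measurable_space[OF \<phi>_count, of X] A_sub that by auto
  have \<phi>_nonneg: "0 \<le> \<phi> X" and \<phi>_le: "\<phi> X \<le> 1" if "X \<in> ?A" for X
    using \<phi>01[OF that] by auto
  have finA: "finite ?A" using S by (intro finite_PiE) auto
  define F0 where "F0 X = (\<Prod>ij\<in>?I. q0 ij (X ij))" for X
  define F where "F w X = (\<Prod>ij\<in>?I. q w ij (X ij))" for w X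
  define M where "M X = (\<Sum>w\<in>W. \<pi> w * F w X)" for X
  define E where "E w = (\<Sum>X\<in>?A. F w X * (1 - \<phi> X))" for w
  have F_nonneg: "0 \<le> F w X" if "w \<in> W" "X \<in> ?A" for w X
    unfolding F_def using that q by (intro prod_nonneg) (auto simp: noise_law_def PiE_iff)
  have F_sum: "(\<Sum>X\<in>?A. F w X) = 1" if "w \<in> W" for w
  proof -
    have "(\<Sum>X\<in>?A. F w X) = (\<Prod>ij\<in>?I. \<Sum>x\<in>S. q w ij x)"
      unfolding F_def using S by (intro prod_sum_PiE[symmetric]) auto
    also have "\<dots> = (\<Prod>ij\<in>?I. 1)"
      using q[OF that] by (intro prod.cong) (auto simp: noise_law_def)
    finally show ?thesis by simp
  qed
  have F0_sum: "(\<Sum>X\<in>?A. F0 X) = 1"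
  proof -
    have "(\<Sum>X\<in>?A. F0 X) = (\<Prod>ij\<in>?I. \<Sum>x\<in>S. q0 ij x)"
      unfolding F0_def using S by (intro prod_sum_PiE[symmetric]) auto
    also have "\<dots> = (\<Prod>ij\<in>?I. 1)"
      using q0 by (intro prod.cong) (auto simp: noise_law_def)
    finally show ?thesis by simp
  qed
  have F0_pos: "0 < F0 X" if "X \<in> ?A" for X
    unfolding F0_def using that q0_pos by (intro prod_pos) (auto simp: PiE_iff)
  have M_sum: "(\<Sum>X\<in>?A. M X) = 1"
    unfolding M_def using W F_sum by (subst sum.swap) (simp flip: sum_distrib_left)
  have cross: "(\<Sum>X\<in>?A. F w X * F w' X / F0 X) =
      (\<Prod>ij\<in>?I. \<Sum>x\<in>S. q w ij x * q w' ij x / q0 ij x)" for w w'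
    unfolding F_def F0_def using S by (subst prod_sum_PiE) (auto simp: prod.distrib prod_dividef)
  have "(\<Sum>X\<in>?A. (M X)\<^sup>2 / F0 X) =
      (\<Sum>X\<in>?A. \<Sum>w\<in>W. \<Sum>w'\<in>W. \<pi> w * \<pi> w' * (F w X * F w' X / F0 X))"
    unfolding M_def power2_eq_square sum_product sum_divide_distrib
    by (intro sum.cong refl) (simp add: mult_ac)
  also have "\<dots> = (\<Sum>w\<in>W. \<Sum>w'\<in>W. \<pi> w * \<pi> w' * (\<Sum>X\<in>?A. F w X * F w' X / F0 X))"
    by (subst sum.swap, intro sum.cong refl, subst sum.swap) (simp add: sum_distrib_left)
  also have "\<dots> \<le> 9 / 8" using chi by (simp add: cross)
  finally have chi': "(\<Sum>X\<in>?A. (M X)\<^sup>2 / F0 X) \<le> 9 / 8" .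
  have main: "5 / 8 \<le> (\<Sum>X\<in>?A. F0 X * \<phi> X) + (\<Sum>X\<in>?A. M X * (1 - \<phi> X))"
    by (rule bayes_error_lower_bound[OF F0_pos F0_sum M_sum chi' \<phi>01])
  have "(\<Sum>X\<in>?A. M X * (1 - \<phi> X)) = (\<Sum>w\<in>W. \<pi> w * E w)"
    unfolding M_def E_def sum_distrib_right sum_distrib_left by (subst sum.swap) (simp add: mult_ac)
  also have "\<dots> = (\<Sum>w\<in>G. \<pi> w * E w) + (\<Sum>w\<in>W - G. \<pi> w * E w)"
    using sum.subset_diff[OF G(1) W(1)] by (simp add: add.commute)
  also have "(\<Sum>w\<in>W - G. \<pi> w * E w) \<le> (\<Sum>w\<in>W - G. \<pi> w)"
  proof (rule sum_mono)
    fix w assume w: "w \<in> W - G"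
    have "E w \<le> (\<Sum>X\<in>?A. F w X)"
      unfolding E_def using w F_nonneg[of w] \<phi>_nonneg by (intro sum_mono mult_left_le) auto
    then show "\<pi> w * E w \<le> \<pi> w"
      using w W(2)[of w] F_sum[of w] by (intro mult_left_le) auto
  qed
  finally have M_le: "(\<Sum>X\<in>?A. M X * (1 - \<phi> X)) \<le> (\<Sum>w\<in>G. \<pi> w * E w) + 1 / 8"
    using G(2) by simp
  define B where "B = (SUP P\<in>noise_class_joint \<alpha> K p n. SUP \<theta>\<in>Theta_alt p n s \<rho>.
        ennreal (data_expectation p n \<theta> P (\<lambda>X. 1 - \<phi> X)))"
  have E_le: "ennreal (E w) \<le> B" if "w \<in> G" for w
  proof -
    have "w \<in> W" using that G by blast
    have "\<exists>P\<in>noise_class_joint \<alpha> K p n. \<forall>f\<in>borel_measurable (mat_borel p n).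
        data_expectation p n (\<theta> w) P f = (\<Sum>X\<in>?A. F w X * f X)"
      unfolding F_def by (rule exists_joint_noise[OF S ne]) (rule q[OF \<open>w \<in> W\<close>])
    then obtain P where P: "P \<in> noise_class_joint \<alpha> K p n"
      and "\<forall>f\<in>borel_measurable (mat_borel p n).
        data_expectation p n (\<theta> w) P f = (\<Sum>X\<in>?A. F w X * f X)"
      by blast
    then have "data_expectation p n (\<theta> w) P (\<lambda>X. 1 - \<phi> X) = E w"
      by (simp add: E_def)
    then show ?thesis
      unfolding B_def using P alt[OF that] by (intro SUP_upper2[of P] SUP_upper2[of "\<theta> w"]) auto
  qed
  have B: "ennreal (\<Sum>w\<in>G. \<pi> w * E w) \<le> B"
  proof (cases B)
    case (real b)
    have "(\<Sum>w\<in>G. \<pi> w * E w) \<le> (\<Sum>w\<in>G. \<pi> w * b)"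
    proof (intro sum_mono mult_left_mono)
      fix w assume w: "w \<in> G"
      then show "E w \<le> b" using E_le[OF w] real by simp
      show "0 \<le> \<pi> w" using w G W by auto
    qed
    also have "\<dots> \<le> (\<Sum>w\<in>W. \<pi> w) * b"
      unfolding sum_distrib_right using G W real by (intro sum_mono2) auto
    finally show ?thesis using W real by (simp add: ennreal_leI)
  qed simp
  have "\<exists>P\<in>noise_class_joint \<alpha> K p n. \<forall>f\<in>borel_measurable (mat_borel p n).
      data_expectation p n (\<lambda>ij\<in>?I. 0) P f = (\<Sum>X\<in>?A. F0 X * f X)"
    unfolding F0_def by (rule exists_joint_noise[OF S ne]) (use q0 in simp)
  then obtain P where P: "P \<in> noise_class_joint \<alpha> K p n"
    and "\<forall>f\<in>borel_measurable (mat_borel p n).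
      data_expectation p n (\<lambda>ij\<in>?I. 0) P f = (\<Sum>X\<in>?A. F0 X * f X)"
    by blast
  then have "data_expectation p n (\<lambda>ij\<in>?I. 0) P \<phi> = (\<Sum>X\<in>?A. F0 X * \<phi> X)"
    by simp
  moreover have "(\<lambda>ij\<in>?I. 0) \<in> Theta_null p n"
    by (auto simp: Theta_null_def mat_borel_def space_PiM mat_index_def intro!: exI[of _ "\<lambda>_. 0"])
  ultimately have A: "ennreal (\<Sum>X\<in>?A. F0 X * \<phi> X) \<le> (SUP P\<in>noise_class_joint \<alpha> K p n. SUP \<theta>\<in>Theta_null p n.
        ennreal (data_expectation p n \<theta> P \<phi>))"
    using P by (intro SUP_upper2[of P] SUP_upper2[of "\<lambda>ij\<in>?I. 0"]) auto
  have nn: "0 \<le> (\<Sum>X\<in>?A. F0 X * \<phi> X)"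
    by (intro sum_nonneg mult_nonneg_nonneg less_imp_le[OF F0_pos] \<phi>_nonneg)
  have nn': "0 \<le> (\<Sum>w\<in>G. \<pi> w * E w)"
    unfolding E_def using G W \<phi>_le
    by (intro sum_nonneg mult_nonneg_nonneg F_nonneg) auto
  have "(1 / 2 :: ennreal) = ennreal (1 / 2)"
    using divide_ennreal[of 1 2] by simp
  also have "\<dots> \<le> ennreal ((\<Sum>X\<in>?A. F0 X * \<phi> X) + (\<Sum>w\<in>G. \<pi> w * E w))"
    using main M_le by (intro ennreal_leI) linarith
  also have "\<dots> = ennreal (\<Sum>X\<in>?A. F0 X * \<phi> X) + ennreal (\<Sum>w\<in>G. \<pi> w * E w)"
    using nn nn' by (rule ennreal_plus)
  also have "\<dots> \<le> testing_error \<alpha> K p n s \<rho> \<phi>"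
    unfolding testing_error_def using A B unfolding B_def by (rule add_mono)
  finally show "1 / 2 \<le> testing_error \<alpha> K p n s \<rho> \<phi>" .
qed

section \<open>Random change points and random signs\<close>

definition nnz :: "nat \<Rightarrow> (nat \<Rightarrow> real) \<Rightarrow> nat" where
  "nnz p \<xi> = card {i \<in> {1..p}. \<xi> i \<noteq> 0}"

abbreviation signs :: "real set" where
  "signs \<equiv> {-1, 0, 1}"

lemma sum_PiE_prod2:
  fixes g :: "'a \<Rightarrow> 'b \<Rightarrow> 'b \<Rightarrow> 'c :: comm_semiring_1"
  assumes "finite A" "finite D"
  shows "(\<Sum>x\<in>A \<rightarrow>\<^sub>E D. \<Sum>y\<in>A \<rightarrow>\<^sub>E D. \<Prod>i\<in>A. g i (x i) (y i)) =
         (\<Prod>i\<in>A. \<Sum>a\<in>D. \<Sum>a'\<in>D. g i a a')"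
  using assms by (simp add: prod_sum_PiE)

lemma prod_if_le_eq_power:
  fixes c :: "'a :: comm_monoid_mult"
  assumes "m \<le> n"
  shows "(\<Prod>t\<in>{1..n}. if t \<le> m then c else 1) = c ^ m"
proof -
  have "(\<Prod>t\<in>{1..n}. if t \<le> m then c else 1) = (\<Prod>t\<in>{1..m}. c)"
    using assms by (intro prod.mono_neutral_cong_right) auto
  then show ?thesis by simp
qed

lemma sum_squares_signs:
  assumes "\<And>i. i \<in> {1..p} \<Longrightarrow> \<xi> i \<in> signs"
  shows "(\<Sum>i\<in>{1..p}. (\<xi> i)\<^sup>2) = real (nnz p \<xi>)"
proof -
  have "(\<Sum>i\<in>{1..p}. (\<xi> i)\<^sup>2) = (\<Sum>i\<in>{1..p}. of_bool (\<xi> i \<noteq> 0))"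
    using assms by (intro sum.cong) fastforce+
  also have "\<dots> = real (nnz p \<xi>)"
    by (simp add: nnz_def Int_def)
  finally show ?thesis .
qed

text \<open>The jump sits before the change point and the mean is 0 afterwards. Since
  \<open>j\<close> lies in the first half, \<open>(n - j) / n\<close> is at least 1/2, which is the
  \<open>/ 2\<close> in the bound on \<open>\<rho>\<close>.\<close>

lemma Theta_altI:
  assumes j: "1 \<le> j" "2 * j \<le> n" and \<xi>: "\<And>i. i \<in> {1..p} \<Longrightarrow> \<xi> i \<in> signs"
    and s: "nnz p \<xi> \<le> s" and \<rho>: "\<rho>\<^sup>2 \<le> real j * b\<^sup>2 * real (nnz p \<xi>) / 2"
  shows "(\<lambda>(i, t)\<in>mat_index p n. if t \<le> j then \<xi> i * b else 0) \<in> Theta_alt p n s \<rho>"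
proof -
  have "l0_norm p (\<lambda>i. \<xi> i * b - 0) \<le> nnz p \<xi>"
    unfolding l0_norm_def nnz_def by (intro card_mono) auto
  then have l0: "l0_norm p (\<lambda>i. \<xi> i * b - 0) \<le> s" using s by simp
  have "(l2_norm p (\<lambda>i. \<xi> i * b - 0))\<^sup>2 = (\<Sum>i\<in>{1..p}. (\<xi> i)\<^sup>2 * b\<^sup>2)"
    by (simp add: l2_norm_def L2_set_def sum_nonneg power_mult_distrib)
  also have "\<dots> = b\<^sup>2 * real (nnz p \<xi>)"
    using sum_squares_signs[OF \<xi>] by (simp flip: sum_distrib_right)
  finally have l2: "(l2_norm p (\<lambda>i. \<xi> i * b - 0))\<^sup>2 = b\<^sup>2 * real (nnz p \<xi>)" .
  have "1 / 2 \<le> (real n - real j) / real n"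
    using j by (simp add: field_simps)
  then have "real j * b\<^sup>2 * real (nnz p \<xi>) * (1 / 2)
      \<le> real j * b\<^sup>2 * real (nnz p \<xi>) * ((real n - real j) / real n)"
    by (intro mult_left_mono) auto
  then have "\<rho>\<^sup>2 \<le> real j * b\<^sup>2 * real (nnz p \<xi>) * ((real n - real j) / real n)"
    using \<rho> by linarith
  then have "\<rho>\<^sup>2 \<le> real j * (real n - real j) / real n * (l2_norm p (\<lambda>i. \<xi> i * b - 0))\<^sup>2"
    unfolding l2 by (simp add: mult_ac)
  then have "(\<lambda>(i, t)\<in>mat_index p n. if t \<le> j then \<xi> i * b else 0) \<in> Theta_at j p n s \<rho>"
    unfolding Theta_at_def using l0
    by - (rule CollectI, rule conjI, simp add: mat_borel_def space_PiM,
        rule exI[of _ "\<lambda>i. \<xi> i * b"], rule exI[of _ "\<lambda>i. 0"], auto simp: mat_index_def)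
  then show ?thesis
    unfolding Theta_alt_def using j by force
qed

text \<open>The prior draws \<open>j\<close> uniformly from \<open>J\<close> and, independently, a
  sign for each row from \<open>r i\<close>. With both change points fixed, the chi-square sum
  factors over rows. Within a row, only the first \<open>min j j'\<close> columns are shifted under
  both draws, whence the power.\<close>

lemma product_prior_lower_bound:
  fixes Q :: "real \<Rightarrow> real" and h :: "nat \<Rightarrow> real \<Rightarrow> real \<Rightarrow> real" and r :: "nat \<Rightarrow> real \<Rightarrow> real"
  assumes S: "finite S" and p: "1 \<le> p"
    and J: "finite J" "J \<noteq> {}" "\<And>j. j \<in> J \<Longrightarrow> 1 \<le> j \<and> 2 * j \<le> n"
    and Q: "noise_law \<alpha> K S 0 Q" "\<And>x. x \<in> S \<Longrightarrow> 0 < Q x"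
    and h: "\<And>j a. j \<in> J \<Longrightarrow> a \<in> signs \<Longrightarrow> noise_law \<alpha> K S (a * b j) (h j a)"
    and r: "\<And>i a. i \<in> {1..p} \<Longrightarrow> a \<in> signs \<Longrightarrow> 0 \<le> r i a"
      "\<And>i. i \<in> {1..p} \<Longrightarrow> (\<Sum>a\<in>signs. r i a) = 1"
    and bad: "(\<Sum>\<xi> | \<xi> \<in> {1..p} \<rightarrow>\<^sub>E signs \<and> \<not> (nnz p \<xi> \<le> s \<and>
        (\<forall>j\<in>J. \<rho>\<^sup>2 \<le> real j * (b j)\<^sup>2 * real (nnz p \<xi>) / 2)). \<Prod>i\<in>{1..p}. r i (\<xi> i)) \<le> 1 / 8"
    and chi: "(\<Sum>j\<in>J. \<Sum>j'\<in>J. \<Prod>i\<in>{1..p}. \<Sum>a\<in>signs. \<Sum>a'\<in>signs.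
        r i a * r i a' * (\<Sum>x\<in>S. h j a x * h j' a' x / Q x) ^ min j j') \<le> 9 / 8 * (real (card J))\<^sup>2"
  shows "1 / 2 \<le> minimax_error \<alpha> K p n s \<rho>"
proof -
  define X where "X = {1..p} \<rightarrow>\<^sub>E signs"
  define good where "good \<xi> \<longleftrightarrow> nnz p \<xi> \<le> s \<and>
    (\<forall>j\<in>J. \<rho>\<^sup>2 \<le> real j * (b j)\<^sup>2 * real (nnz p \<xi>) / 2)" for \<xi>
  define w where "w \<xi> = (\<Prod>i\<in>{1..p}. r i (\<xi> i))" for \<xi>
  define \<pi> where "\<pi> = (\<lambda>(j :: nat, \<xi>). w \<xi> / real (card J))"
  define \<theta> where "\<theta> = (\<lambda>(j, \<xi>). \<lambda>(i, t)\<in>mat_index p n. if t \<le> j then \<xi> i * b j else 0)"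
  define q where "q = (\<lambda>(j, \<xi>) (i :: nat, t). if t \<le> j then h j (\<xi> i) else Q)"
  define G where "G = J \<times> {\<xi> \<in> X. good \<xi>}"
  have cJ: "0 < real (card J)" using J by (simp add: card_gt_0_iff)
  have finX: "finite X" unfolding X_def by (intro finite_PiE) auto
  have X_signs: "\<xi> i \<in> signs" if "\<xi> \<in> X" "i \<in> {1..p}" for \<xi> i
    using that unfolding X_def by (rule PiE_mem)
  have w_nonneg: "0 \<le> w \<xi>" if "\<xi> \<in> X" for \<xi>
    unfolding w_def using r X_signs[OF that] by (intro prod_nonneg) blast
  have "(\<Sum>\<xi>\<in>X. w \<xi>) = (\<Prod>i\<in>{1..p}. \<Sum>a\<in>signs. r i a)"
    unfolding w_def X_def by (intro prod_sum_PiE[symmetric]) auto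
  also have "\<dots> = 1" using r(2) by (intro prod.neutral) auto
  finally have w_sum: "(\<Sum>\<xi>\<in>X. w \<xi>) = 1" .
  have J_pos: "1 \<le> j" and J_le: "2 * j \<le> n" if "j \<in> J" for j
    using J(3)[OF that] by auto
  show ?thesis
  proof (rule minimax_error_lower_bound)
    show "finite S" by fact
    show "mat_index p n \<noteq> {}"
      using p J by (fastforce simp: mat_index_def)
    show "finite (J \<times> X)" using J finX by simp
    show "0 \<le> \<pi> v" if "v \<in> J \<times> X" for v
      using that w_nonneg by (auto simp: \<pi>_def)
    show "(\<Sum>v\<in>J \<times> X. \<pi> v) = 1"
      using cJ w_sum by (simp add: \<pi>_def sum.cartesian_product[symmetric] flip: sum_divide_distrib)
    show "G \<subseteq> J \<times> X" by (auto simp: G_def)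
    \<comment> \<open>\<open>good\<close> demands the signal bound for all \<open>j\<close> in
      \<open>J\<close> at once, so the bad event concerns \<open>\<xi>\<close> alone and the uniform
      weight of \<open>j\<close> sums out.\<close>
    have "J \<times> X - G = J \<times> {\<xi> \<in> X. \<not> good \<xi>}" by (auto simp: G_def)
    then show "(\<Sum>v\<in>J \<times> X - G. \<pi> v) \<le> 1 / 8"
      using cJ bad
      by (simp add: \<pi>_def sum.cartesian_product[symmetric] X_def w_def good_def flip: sum_divide_distrib)
    show "noise_law \<alpha> K S 0 Q" by fact
    show "0 < Q x" if "x \<in> S" for x using Q that by blast
    show "noise_law \<alpha> K S (\<theta> v ij) (q v ij)" if "v \<in> J \<times> X" "ij \<in> mat_index p n" for v ij
    proof -
      obtain j \<xi> i t where [simp]: "v = (j, \<xi>)" "ij = (i, t)" by (cases v, cases ij) auto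
      have "\<xi> i \<in> signs" "j \<in> J"
        using that X_signs[of \<xi> i] by (auto simp: mat_index_def)
      then show ?thesis
        using h[of j "\<xi> i"] Q that by (auto simp: \<theta>_def q_def)
    qed
    show "\<theta> v \<in> Theta_alt p n s \<rho>" if "v \<in> G" for v
    proof -
      obtain j \<xi> where [simp]: "v = (j, \<xi>)" by (cases v) auto
      have *: "j \<in> J" "\<xi> \<in> X" "good \<xi>" using that by (auto simp: G_def)
      have "(\<lambda>(i, t)\<in>mat_index p n. if t \<le> j then \<xi> i * b j else 0) \<in> Theta_alt p n s \<rho>"
        using * by (intro Theta_altI J_pos J_le X_signs) (auto simp: good_def)
      then show ?thesis by (simp add: \<theta>_def)
    qed
    have prod_t: "(\<Prod>ij\<in>mat_index p n. \<Sum>x\<in>S. q (j, \<xi>) ij x * q (j', \<xi>') ij x / Q x) =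
        (\<Prod>i\<in>{1..p}. (\<Sum>x\<in>S. h j (\<xi> i) x * h j' (\<xi>' i) x / Q x) ^ min j j')"
      if "j \<in> J" "j' \<in> J" "\<xi> \<in> X" "\<xi>' \<in> X" for j j' \<xi> \<xi>'
    proof -
      \<comment> \<open>Once one of the two laws is the null law \<open>Q\<close>, the correlation
        is the total mass of the other.\<close>
      have one: "(\<Sum>x\<in>S. g x * Q x / Q x) = 1" "(\<Sum>x\<in>S. Q x * g x / Q x) = 1"
        if "noise_law \<alpha> K S \<mu> g" for g \<mu>
      proof -
        have "(\<Sum>x\<in>S. g x * Q x / Q x) = (\<Sum>x\<in>S. g x)" "(\<Sum>x\<in>S. Q x * g x / Q x) = (\<Sum>x\<in>S. g x)"
          using Q(2) by (auto intro!: sum.cong simp: less_imp_neq[symmetric])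
        then show "(\<Sum>x\<in>S. g x * Q x / Q x) = 1" "(\<Sum>x\<in>S. Q x * g x / Q x) = 1"
          using that by (auto simp: noise_law_def)
      qed
      have "(\<Sum>x\<in>S. q (j, \<xi>) (i, t) x * q (j', \<xi>') (i, t) x / Q x) =
          (if t \<le> min j j' then (\<Sum>x\<in>S. h j (\<xi> i) x * h j' (\<xi>' i) x / Q x) else 1)"
        if "i \<in> {1..p}" for i t
        using one[OF h[of j "\<xi> i"]] one[OF h[of j' "\<xi>' i"]] one[OF Q(1)]
          X_signs[OF \<open>\<xi> \<in> X\<close> that] X_signs[OF \<open>\<xi>' \<in> X\<close> that] \<open>j \<in> J\<close> \<open>j' \<in> J\<close>
        by (auto simp: q_def)
      then have "(\<Prod>ij\<in>mat_index p n. \<Sum>x\<in>S. q (j, \<xi>) ij x * q (j', \<xi>') ij x / Q x) =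
          (\<Prod>i\<in>{1..p}. \<Prod>t\<in>{1..n}. if t \<le> min j j' then (\<Sum>x\<in>S. h j (\<xi> i) x * h j' (\<xi>' i) x / Q x) else 1)"
        unfolding mat_index_def prod.cartesian_product by (intro prod.cong) auto
      also have "\<dots> = (\<Prod>i\<in>{1..p}. (\<Sum>x\<in>S. h j (\<xi> i) x * h j' (\<xi>' i) x / Q x) ^ min j j')"
        using J_le[OF \<open>j \<in> J\<close>] by (intro prod.cong refl prod_if_le_eq_power) auto
      finally show ?thesis .
    qed
    let ?h = "\<lambda>j j' i a a'. r i a * r i a' * (\<Sum>x\<in>S. h j a x * h j' a' x / Q x) ^ min j j'"
    have "(\<Sum>v\<in>J \<times> X. \<Sum>v'\<in>J \<times> X. \<pi> v * \<pi> v' *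
       (\<Prod>ij\<in>mat_index p n. \<Sum>x\<in>S. q v ij x * q v' ij x / Q x)) =
      (\<Sum>j\<in>J. \<Sum>\<xi>\<in>X. \<Sum>j'\<in>J. \<Sum>\<xi>'\<in>X. (\<Prod>i\<in>{1..p}. ?h j j' i (\<xi> i) (\<xi>' i)) / (real (card J))\<^sup>2)"
      unfolding sum.cartesian_product' case_prod_conv
      by (intro sum.cong refl, subst prod_t)
         (auto simp: \<pi>_def w_def prod.distrib power2_eq_square)
    also have "\<dots> = (\<Sum>j\<in>J. \<Sum>j'\<in>J. \<Sum>\<xi>\<in>X. \<Sum>\<xi>'\<in>X. (\<Prod>i\<in>{1..p}. ?h j j' i (\<xi> i) (\<xi>' i)) / (real (card J))\<^sup>2)"
      by (intro sum.cong refl sum.swap)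
    also have "\<dots> = (\<Sum>j\<in>J. \<Sum>j'\<in>J. \<Prod>i\<in>{1..p}. \<Sum>a\<in>signs. \<Sum>a'\<in>signs. ?h j j' i a a') / (real (card J))\<^sup>2"
      unfolding X_def by (subst sum_PiE_prod2[symmetric]) (auto simp: sum_divide_distrib)
    also have "\<dots> \<le> 9 / 8"
      using chi cJ by (subst pos_divide_le_eq) auto
    finally show "(\<Sum>v\<in>J \<times> X. \<Sum>v'\<in>J \<times> X. \<pi> v * \<pi> v' *
       (\<Prod>ij\<in>mat_index p n. \<Sum>x\<in>S. q v ij x * q v' ij x / Q x)) \<le> 9 / 8" .
  qed
qed

section \<open>Sparse random signs and concentration of their support size\<close>

definition sparse_weight :: "real \<Rightarrow> real \<Rightarrow> real" where
  "sparse_weight \<epsilon> a = (if a = 0 then 1 - \<epsilon> else \<epsilon> / 2)"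

lemma sparse_weight_nonneg: "0 \<le> \<epsilon> \<Longrightarrow> \<epsilon> \<le> 1 \<Longrightarrow> 0 \<le> sparse_weight \<epsilon> a"
  by (simp add: sparse_weight_def)

lemma sum_sparse_weight: "(\<Sum>a\<in>signs. sparse_weight \<epsilon> a) = 1"
  by (simp add: sparse_weight_def)

text \<open>The support size is binomial, with moment generating function
  \<open>(1 + \<epsilon> * (exp u - 1)) ^ p\<close>; the bound is the Poisson one.\<close>

lemma nnz_mgf:
  assumes "0 \<le> \<epsilon>" "\<epsilon> \<le> 1"
  shows "(\<Sum>\<xi>\<in>{1..p} \<rightarrow>\<^sub>E signs. (\<Prod>i\<in>{1..p}. sparse_weight \<epsilon> (\<xi> i)) * exp (u * real (nnz p \<xi>)))
         \<le> exp (real p * \<epsilon> * (exp u - 1))"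
proof -
  have nnz: "real (nnz p \<xi>) = (\<Sum>i\<in>{1..p}. of_bool (\<xi> i \<noteq> 0))" for \<xi>
    by (simp add: nnz_def Int_def)
  have "(\<Prod>i\<in>{1..p}. sparse_weight \<epsilon> (\<xi> i)) * exp (u * real (nnz p \<xi>)) =
      (\<Prod>i\<in>{1..p}. sparse_weight \<epsilon> (\<xi> i) * exp (u * of_bool (\<xi> i \<noteq> 0)))" for \<xi>
    by (simp only: nnz sum_distrib_left exp_sum[OF finite_atLeastAtMost] prod.distrib)
  then have "(\<Sum>\<xi>\<in>{1..p} \<rightarrow>\<^sub>E signs. (\<Prod>i\<in>{1..p}. sparse_weight \<epsilon> (\<xi> i)) * exp (u * real (nnz p \<xi>))) =
      (\<Prod>i\<in>{1..p}. \<Sum>a\<in>signs. sparse_weight \<epsilon> a * exp (u * of_bool (a \<noteq> 0)))"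
    by (subst prod_sum_PiE) auto
  also have "\<dots> = (1 + \<epsilon> * (exp u - 1)) ^ p"
    by (simp add: sparse_weight_def algebra_simps)
  also have "\<dots> \<le> exp (\<epsilon> * (exp u - 1)) ^ p"
  proof (rule power_mono)
    have "\<epsilon> * (1 - exp u) \<le> 1"
    proof (cases "exp u \<le> 1")
      case True
      then show ?thesis using assms by (intro mult_le_one) auto
    next
      case False
      then show ?thesis using assms by (intro order.trans[OF mult_nonneg_nonpos]) auto
    qed
    then show "0 \<le> 1 + \<epsilon> * (exp u - 1)" by (simp add: algebra_simps)
  qed simp
  also have "\<dots> = exp (real p * \<epsilon> * (exp u - 1))"
    by (simp add: mult.assoc flip: exp_of_nat_mult)
  finally show ?thesis .
qed

text \<open>The expected support size is \<open>s / 8\<close>, so both ends of the window from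
  \<open>s / 32\<close> to \<open>s\<close> are a constant factor away and each tail is
  exponentially small in \<open>s\<close>.\<close>

lemma nnz_concentration:
  assumes s: "512 \<le> s" "s \<le> p" and \<epsilon>: "\<epsilon> = real s / (8 * real p)"
    and good: "\<And>\<xi>. nnz p \<xi> \<le> s \<Longrightarrow> real s / 32 \<le> real (nnz p \<xi>) \<Longrightarrow> good \<xi>"
  shows "(\<Sum>\<xi> | \<xi> \<in> {1..p} \<rightarrow>\<^sub>E signs \<and> \<not> good \<xi>. \<Prod>i\<in>{1..p}. sparse_weight \<epsilon> (\<xi> i)) \<le> 1 / 8"
proof -
  have p\<epsilon>: "real p * \<epsilon> = real s / 8" and \<epsilon>01: "0 \<le> \<epsilon>" "\<epsilon> \<le> 1"
    using s by (auto simp: \<epsilon> field_simps)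
  let ?X = "{1..p} \<rightarrow>\<^sub>E signs"
  let ?w = "\<lambda>\<xi>. \<Prod>i\<in>{1..p}. sparse_weight \<epsilon> (\<xi> i)"
  \<comment> \<open>Chernoff: on the bad set one of the two exponentials is at least 1.\<close>
  let ?e = "\<lambda>\<xi>. exp (- real s) * exp (1 * real (nnz p \<xi>)) + exp (real s / 32) * exp (- 1 * real (nnz p \<xi>))"
  have w: "0 \<le> ?w \<xi>" for \<xi>
    using \<epsilon>01 by (intro prod_nonneg sparse_weight_nonneg) auto
  have e: "1 \<le> ?e \<xi>" if "\<not> good \<xi>" for \<xi>
  proof (cases "nnz p \<xi> \<le> s")
    case True
    then have "real (nnz p \<xi>) \<le> real s / 32" using good that by force
    then have "1 \<le> exp (real s / 32) * exp (- 1 * real (nnz p \<xi>))"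
      by (simp flip: exp_add)
    then show ?thesis by (simp add: add_increasing)
  next
    case False
    then have "1 \<le> exp (- real s) * exp (1 * real (nnz p \<xi>))"
      by (simp flip: exp_add)
    then show ?thesis by (simp add: add_increasing2)
  qed
  have "(\<Sum>\<xi> | \<xi> \<in> ?X \<and> \<not> good \<xi>. ?w \<xi>) \<le> (\<Sum>\<xi> | \<xi> \<in> ?X \<and> \<not> good \<xi>. ?w \<xi> * ?e \<xi>)"
  proof (rule sum_mono)
    fix \<xi> assume "\<xi> \<in> {\<xi>. \<xi> \<in> ?X \<and> \<not> good \<xi>}"
    then have "1 \<le> ?e \<xi>" using e by blast
    then show "?w \<xi> \<le> ?w \<xi> * ?e \<xi>"
      using mult_left_mono[OF _ w, of 1 "?e \<xi>" \<xi>] by simp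
  qed
  also have "\<dots> \<le> (\<Sum>\<xi>\<in>?X. ?w \<xi> * ?e \<xi>)"
    using w by (intro sum_mono2 mult_nonneg_nonneg finite_PiE) auto
  also have "\<dots> = exp (- real s) * (\<Sum>\<xi>\<in>?X. ?w \<xi> * exp (1 * real (nnz p \<xi>))) +
      exp (real s / 32) * (\<Sum>\<xi>\<in>?X. ?w \<xi> * exp (- 1 * real (nnz p \<xi>)))"
    by (simp only: ring_distribs sum.distrib sum_distrib_left mult_ac)
  also have "\<dots> \<le> exp (- real s) * exp (real p * \<epsilon> * (exp 1 - 1)) +
      exp (real s / 32) * exp (real p * \<epsilon> * (exp (- 1) - 1))"
    by (intro add_mono mult_left_mono nnz_mgf \<epsilon>01) auto
  also have "\<dots> \<le> exp (- 16) + exp (- 16)"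
  proof -
    have "real s / 8 * (exp 1 - 1) \<le> real s / 8 * 2"
      using exp_le by (intro mult_left_mono) auto
    then have 1: "- real s + real p * \<epsilon> * (exp 1 - 1) \<le> - 16"
      using s unfolding p\<epsilon> by linarith
    have "exp (- 1 :: real) \<le> 1 / 2"
      using exp_ge_add_one_self[of "1 :: real"] by (simp add: exp_minus field_simps)
    then have "real s / 8 * (exp (- 1) - 1) \<le> real s / 8 * (- 1 / 2)"
      by (intro mult_left_mono) auto
    \<comment> \<open>The exponent is at most \<open>s / 32 - s / 16 = - s / 32\<close>; this is
      where 512 = 16 * 32 comes from.\<close>
    then have 2: "real s / 32 + real p * \<epsilon> * (exp (- 1) - 1) \<le> - 16"
      using s unfolding p\<epsilon> by linarith
    show ?thesis
      unfolding exp_add[symmetric] using 1 2 by (intro add_mono) simp_all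
  qed
  also have "\<dots> \<le> 1 / 8"
    using exp_ge_add_one_self[of "16 :: real"] by (simp add: exp_minus field_simps)
  finally show ?thesis .
qed

section \<open>Overlaps of dyadic change points\<close>

lemma exp_mult_le_chord:
  fixes a t :: real
  assumes "0 \<le> a" "0 \<le> t" "t \<le> 1"
  shows "exp (a * t) \<le> 1 + t * (exp a - 1)"
proof (cases "a = 0")
  case False
  then have "exp (a * ((1 - t) *\<^sub>R 0 + t *\<^sub>R 1)) \<le> (1 - t) * exp (a * 0) + t * exp (a * 1)"
    using assms by (intro convex_onD[OF convex_on_exp]) auto
  then show ?thesis by (simp add: algebra_simps)
qed simp

lemma exp_le_quadratic:
  fixes u :: real
  assumes "\<bar>u\<bar> \<le> 1"
  shows "exp u \<le> 1 + u + u\<^sup>2"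
proof (cases "0 \<le> u")
  case True
  then show ?thesis using assms exp_bound by simp
next
  case False
  \<comment> \<open>For negative arguments the claim reads
    \<open>1 <= (1 - w + w^2) * exp w\<close>, and the quadratic Taylor lower bound of
    \<open>exp w\<close> suffices.\<close>
  define w where "w = - u"
  have w: "0 \<le> w" "w \<le> 1" using False assms by (auto simp: w_def)
  have "(1 - w + w\<^sup>2) * (1 + w + w\<^sup>2 / 2) = 1 + w\<^sup>2 / 2 + w ^ 3 / 2 + w ^ 4 / 2"
    by (simp add: field_simps power2_eq_square power3_eq_cube power4_eq_xxxx)
  then have "1 \<le> (1 - w + w\<^sup>2) * (1 + w + w\<^sup>2 / 2)" using w by simp
  also have "\<dots> \<le> (1 - w + w\<^sup>2) * exp w"
    using w exp_lower_Taylor_quadratic[OF w(1)] by (intro mult_left_mono) auto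
  finally show ?thesis
    by (simp add: w_def exp_minus field_simps)
qed

lemma sum_half_power_inj_le:
  assumes "finite F" "inj_on g F"
  shows "(\<Sum>i\<in>F. (1 / 2 :: real) ^ g i) \<le> 2"
proof -
  have "(\<Sum>i\<in>F. (1 / 2 :: real) ^ g i) = (\<Sum>k\<in>g ` F. (1 / 2) ^ k)"
    using assms by (simp add: sum.reindex)
  also have "\<dots> \<le> (\<Sum>k. (1 / 2) ^ k)"
    using assms by (intro sum_le_suminf) auto
  also have "\<dots> = 2" by (subst suminf_geometric) auto
  finally show ?thesis .
qed

text \<open>The cosine of the angle between the indicator vectors of the first \<open>j\<close> and
  the first \<open>j'\<close> columns.\<close>

definition overlap :: "nat \<Rightarrow> nat \<Rightarrow> real" where
  "overlap j j' = real (min j j') / (sqrt (real j) * sqrt (real j'))"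

lemma overlap_nonneg: "0 \<le> overlap j j'"
  by (simp add: overlap_def)

lemma overlap_commute: "overlap j j' = overlap j' j"
  by (simp add: overlap_def min.commute mult.commute)

lemma overlap_le_1: "overlap j j' \<le> 1"
proof (induction j j' rule: linorder_wlog)
  case (le j j')
  show ?case
  proof (cases "j = 0")
    case False
    have "real j = sqrt (real j) * sqrt (real j)" by simp
    also have "\<dots> \<le> sqrt (real j) * sqrt (real j')"
      using le by (intro mult_left_mono) auto
    finally show ?thesis
      using le False by (simp add: overlap_def min_def divide_le_eq)
  qed (simp add: overlap_def)
qed (simp add: overlap_commute)

lemma sqrt_power4: "sqrt (4 ^ k) = 2 ^ k"
proof -
  have "(4 :: real) ^ k = (2 ^ k)\<^sup>2"
    by (simp add: power2_eq_square flip: power_mult_distrib)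
  then show ?thesis by (metis real_sqrt_abs abs_of_nonneg zero_le_numeral zero_le_power)
qed

lemma overlap_power4:
  assumes "k \<le> l"
  shows "overlap (4 ^ k) (4 ^ l) = (1 / 2) ^ (l - k)"
proof -
  have "(4 :: real) ^ k = 2 ^ k * 2 ^ k"
    by (simp flip: power_mult_distrib)
  moreover have "(2 :: real) ^ l = 2 ^ k * 2 ^ (l - k)"
    using assms by (simp flip: power_add)
  moreover have "min (4 ^ k) (4 ^ l) = (4 ^ k :: nat)"
    using assms by simp
  ultimately show ?thesis
    by (simp add: overlap_def sqrt_power4 power_one_over)
qed

text \<open>Overlaps decay geometrically on either side of \<open>k\<close>, each side contributing
  at most 2 whatever the size of \<open>E\<close>: profiles at different scales are nearly
  orthogonal.\<close>

lemma sum_overlap_power4_le: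
  assumes "finite E"
  shows "(\<Sum>l\<in>E. overlap (4 ^ k) (4 ^ l)) \<le> 4"
proof -
  have "(\<Sum>l\<in>E. overlap (4 ^ k) (4 ^ l)) =
      (\<Sum>l | l \<in> E \<and> k \<le> l. overlap (4 ^ k) (4 ^ l)) + (\<Sum>l | l \<in> E \<and> \<not> k \<le> l. overlap (4 ^ k) (4 ^ l))"
    using assms by (subst sum.union_disjoint[symmetric]) (auto intro!: sum.cong)
  also have "(\<Sum>l | l \<in> E \<and> k \<le> l. overlap (4 ^ k) (4 ^ l)) = (\<Sum>l | l \<in> E \<and> k \<le> l. (1 / 2) ^ (l - k))"
    by (intro sum.cong) (auto simp: overlap_power4)
  also have "\<dots> \<le> 2"
    using assms by (intro sum_half_power_inj_le) (auto simp: inj_on_def)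
  also have "(\<Sum>l | l \<in> E \<and> \<not> k \<le> l. overlap (4 ^ k) (4 ^ l)) = (\<Sum>l | l \<in> E \<and> \<not> k \<le> l. (1 / 2) ^ (k - l))"
    by (intro sum.cong) (auto simp: overlap_power4 overlap_commute[of "4 ^ k"])
  also have "\<dots> \<le> 2"
    using assms by (intro sum_half_power_inj_le) (auto simp: inj_on_def)
  finally show ?thesis by simp
qed

lemma exists_dyadic_grid:
  assumes "2 \<le> n"
  shows "\<exists>E. finite E \<and> E \<noteq> {} \<and> (\<forall>k\<in>E. 2 * 4 ^ k \<le> n \<and> card E \<le> 4 ^ k) \<and>
    ln (8 * real n) \<le> 9 * real (card E)"
proof -
  obtain M where M: "4 ^ M \<le> n div 2" "n div 2 < 4 ^ (M + 1)"
    using ex_power_ivl1[of 4 "n div 2"] assms by (auto simp: Suc_le_eq)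
  \<comment> \<open>The upper half of the available exponents still has size of order
    \<open>ln n\<close>, while \<open>2 * k >= M\<close> makes even the smallest change point at
    least \<open>card E\<close>. This later keeps the jump in a single row at most 1.\<close>
  define E where "E = {M - M div 2..M}"
  have card: "card E = M div 2 + 1" by (simp add: E_def)
  have "2 * 4 ^ k \<le> n" "card E \<le> 4 ^ k" if "k \<in> E" for k
  proof -
    have "(4 :: nat) ^ k \<le> 4 ^ M" using that by (intro power_increasing) (auto simp: E_def)
    then show "2 * 4 ^ k \<le> n" using M(1) by linarith
    have "card E \<le> 2 ^ M"
      using less_exp[of M] card by linarith
    also have "(2 :: nat) ^ M \<le> 2 ^ (2 * k)"
      using that by (intro power_increasing) (auto simp: E_def)
    also have "\<dots> = 4 ^ k" by (simp add: power_mult)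
    finally show "card E \<le> 4 ^ k" .
  qed
  moreover have "ln (8 * real n) \<le> 9 * real (card E)"
  proof -
    have "n < 2 * 4 ^ (M + 1)" using M(2) by linarith
    then have "8 * n < 4 ^ (M + 3)" by (simp add: power_add)
    then have "8 * real n < 4 ^ (M + 3)"
      by (metis of_nat_less_iff of_nat_mult of_nat_numeral of_nat_power)
    then have "ln (8 * real n) \<le> ln (4 ^ (M + 3))"
      using assms by (subst ln_le_cancel_iff) auto
    also have "\<dots> = real (M + 3) * ln 4" by (rule ln_realpow)
    also have "ln (4 :: real) = 2 * ln 2"
      using ln_realpow[of 2 2] by simp
    also have "real (M + 3) * (2 * ln 2) \<le> real (M + 3) * (2 * (25 / 36))"
      using ln2_le_25_over_36 by (intro mult_left_mono) auto
    also have "\<dots> \<le> 9 * real (card E)"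
    proof -
      have "real M \<le> 2 * real (M div 2) + 1" by linarith
      then show ?thesis by (simp add: card)
    qed
    finally show ?thesis .
  qed
  ultimately show ?thesis by (intro exI[of _ E]) (auto simp: E_def)
qed

lemma ln_ln_ge_0:
  assumes "2 \<le> n"
  shows "1 \<le> ln (8 * real n)" "0 \<le> ln (ln (8 * real n))" "ln (ln (8 * real n)) \<le> ln (8 * real n)"
proof -
  have "exp 1 \<le> 8 * real n" using exp_le assms by linarith
  then show 1: "1 \<le> ln (8 * real n)"
    using assms by (subst ln_ge_iff) auto
  show "0 \<le> ln (ln (8 * real n))" using 1 by simp
  show "ln (ln (8 * real n)) \<le> ln (8 * real n)"
    using 1 ln_less_self[of "ln (8 * real n)"] by linarith
qed

text \<open>The chord bound is used twice. First it gives
  \<open>exp a - 1 <= ln (8 * n) / 288 <= card E / 32\<close>, with 288 = 9 * 32. Then it makes the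
  excess over 1 linear in the overlap, whose row sums are at most 4; so the relative excess is 4/32
  = 1/8.\<close>

lemma sum_exp_overlap_le:
  assumes n: "2 \<le> n" and E: "finite E" "E \<noteq> {}" "ln (8 * real n) \<le> 9 * real (card E)"
    and a: "0 \<le> a" "a \<le> ln (ln (8 * real n)) / 288"
  shows "(\<Sum>j\<in>(\<lambda>k. 4 ^ k) ` E. \<Sum>j'\<in>(\<lambda>k. 4 ^ k) ` E. exp (a * overlap j j')) \<le> 9 / 8 * (real (card E))\<^sup>2"
proof -
  have inj: "inj_on (\<lambda>k. 4 ^ k :: nat) E" by (auto simp: inj_on_def)
  have ea: "exp a - 1 \<le> real (card E) / 32"
  proof -
    have "exp a \<le> exp (ln (ln (8 * real n)) * (1 / 288))" using a by simp
    also have "\<dots> \<le> 1 + 1 / 288 * (exp (ln (ln (8 * real n))) - 1)"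
      using ln_ln_ge_0[OF n] by (intro exp_mult_le_chord) auto
    also have "exp (ln (ln (8 * real n))) = ln (8 * real n)"
      using ln_ln_ge_0(1)[OF n] by simp
    finally show ?thesis using E(3) by (simp add: field_simps)
  qed
  have "(\<Sum>j\<in>(\<lambda>k. 4 ^ k) ` E. \<Sum>j'\<in>(\<lambda>k. 4 ^ k) ` E. exp (a * overlap j j')) =
      (\<Sum>k\<in>E. \<Sum>l\<in>E. exp (a * overlap (4 ^ k) (4 ^ l)))"
    using inj by (simp add: sum.reindex)
  also have "\<dots> \<le> (\<Sum>k\<in>E. \<Sum>l\<in>E. 1 + overlap (4 ^ k) (4 ^ l) * (exp a - 1))"
    using a by (intro sum_mono exp_mult_le_chord overlap_nonneg overlap_le_1) auto
  also have "\<dots> = (\<Sum>k\<in>E. real (card E) + (exp a - 1) * (\<Sum>l\<in>E. overlap (4 ^ k) (4 ^ l)))"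
    by (simp add: sum.distrib sum_distrib_left mult.commute)
  also have "\<dots> \<le> (\<Sum>k\<in>E. real (card E) + real (card E) / 32 * 4)"
    using E a ea by (intro sum_mono add_left_mono mult_mono sum_overlap_power4_le sum_nonneg overlap_nonneg) auto
  also have "\<dots> = 9 / 8 * (real (card E))\<^sup>2"
    by (simp add: power2_eq_square)
  finally show ?thesis .
qed

section \<open>Three-point laws\<close>

text \<open>The law on \<open>{-2, 0, 2}\<close> with mean \<open>\<mu>\<close> and second moment \<open>m\<close>.\<close>

definition tri :: "real \<Rightarrow> real \<Rightarrow> real \<Rightarrow> real" where
  "tri \<mu> m x = (m / 8 + \<mu> / 4) * of_bool (x = 2) + (m / 8 - \<mu> / 4) * of_bool (x = -2)
     + (1 - m / 4) * of_bool (x = 0)"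

lemma sum_of_bool_eq_mult:
  fixes g :: "'a \<Rightarrow> real"
  assumes "finite S" "c \<in> S"
  shows "(\<Sum>x\<in>S. k * of_bool (x = c) * g x) = k * g c"
proof -
  have "(\<Sum>x\<in>S. k * of_bool (x = c) * g x) = (\<Sum>x\<in>S. if x = c then k * g c else 0)"
    by (intro sum.cong) auto
  then show ?thesis using assms by simp
qed

lemma sum_tri:
  assumes "finite S" "{-2, 0, 2} \<subseteq> S"
  shows "(\<Sum>x\<in>S. tri \<mu> m x * g x) = (m / 8 + \<mu> / 4) * g 2 + (m / 8 - \<mu> / 4) * g (-2) + (1 - m / 4) * g 0"
  using assms by (simp only: tri_def distrib_right sum.distrib) (simp only: sum_of_bool_eq_mult insert_subset)

text \<open>The number 3 covers all distances from points of \<open>{-2, 0, 2}\<close> to a mean in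
  \<open>[-1, 1]\<close>. The value 21/16 = 1 + 1/4 + 1/16 leaves room below 2 for the far atoms of
  the sparse regime.\<close>

lemma exp_powr_le:
  fixes \<alpha> K y :: real
  assumes "0 < \<alpha>" "0 < K" "(3 / K) powr \<alpha> \<le> 1 / 4" "\<bar>y\<bar> \<le> 3"
  shows "exp (\<bar>y / K\<bar> powr \<alpha>) \<le> 21 / 16"
proof -
  have "\<bar>y / K\<bar> powr \<alpha> \<le> (3 / K) powr \<alpha>"
    using assms by (intro powr_mono2) (auto simp: abs_div divide_right_mono)
  then have "exp (\<bar>y / K\<bar> powr \<alpha>) \<le> exp (1 / 4)" using assms by simp
  also have "\<dots> \<le> 21 / 16"
    using exp_bound[of "1 / 4"] by (simp add: power2_eq_square)
  finally show ?thesis .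
qed

lemma tri_nonneg:
  assumes "2 * \<bar>\<mu>\<bar> \<le> m" "m \<le> 4"
  shows "0 \<le> tri \<mu> m x"
proof -
  have "0 \<le> m / 8 + \<mu> / 4" "0 \<le> m / 8 - \<mu> / 4" using assms by linarith+
  then show ?thesis using assms by (simp add: tri_def)
qed

text \<open>Second moment \<open>1 + \<mu>^2\<close> means unit variance about \<open>\<mu>\<close>.
  The weights at 2 and -2 are then \<open>(1 + \<mu>)^2 / 8\<close> and
  \<open>(1 - \<mu>)^2 / 8\<close>.\<close>

lemma noise_law_tri:
  assumes S: "finite S" "{-2, 0, 2} \<subseteq> S"
    and K: "0 < \<alpha>" "0 < K" "(3 / K) powr \<alpha> \<le> 1 / 4" and \<mu>: "\<bar>\<mu>\<bar> \<le> 1"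
  shows "noise_law \<alpha> K S \<mu> (tri \<mu> (1 + \<mu>\<^sup>2))"
proof -
  have "0 \<le> (1 - \<bar>\<mu>\<bar>)\<^sup>2" by simp
  then have m: "2 * \<bar>\<mu>\<bar> \<le> 1 + \<mu>\<^sup>2" by (simp add: power2_eq_square algebra_simps)
  have m4: "1 + \<mu>\<^sup>2 \<le> 4" using \<mu> abs_square_le_1[of \<mu>] by linarith
  let ?e = "\<lambda>x. exp (\<bar>(x - \<mu>) / K\<bar> powr \<alpha>)"
  have nn: "0 \<le> (1 + \<mu>\<^sup>2) / 8 + \<mu> / 4" "0 \<le> (1 + \<mu>\<^sup>2) / 8 - \<mu> / 4" "0 \<le> 1 - (1 + \<mu>\<^sup>2) / 4"
    using m m4 by (simp_all add: add_divide_distrib abs_if split: if_splits)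
  have "(\<Sum>x\<in>S. tri \<mu> (1 + \<mu>\<^sup>2) x * ?e x) \<le>
     ((1 + \<mu>\<^sup>2) / 8 + \<mu> / 4) * 2 + ((1 + \<mu>\<^sup>2) / 8 - \<mu> / 4) * 2 + (1 - (1 + \<mu>\<^sup>2) / 4) * 2"
    unfolding sum_tri[OF S] using \<mu>
    by (intro add_mono mult_left_mono nn order.trans[OF exp_powr_le[OF K]]) auto
  also have "\<dots> = 2" by (simp add: field_simps)
  finally have "(\<Sum>x\<in>S. tri \<mu> (1 + \<mu>\<^sup>2) x * ?e x) \<le> 2" .
  moreover have "(\<Sum>x\<in>S. tri \<mu> (1 + \<mu>\<^sup>2) x) = 1"
    using sum_tri[OF S, of _ _ "\<lambda>_. 1"] by (simp add: field_simps)
  moreover have "(\<Sum>x\<in>S. tri \<mu> (1 + \<mu>\<^sup>2) x * (x - \<mu>)) = 0" "(\<Sum>x\<in>S. tri \<mu> (1 + \<mu>\<^sup>2) x * (x - \<mu>)\<^sup>2) = 1"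
    unfolding sum_tri[OF S] by (simp_all add: field_simps power2_eq_square)
  ultimately show ?thesis
    using tri_nonneg[OF m m4] by (simp add: noise_law_def)
qed

text \<open>The likelihood ratio is \<open>1 + \<mu> * x + \<mu>^2 * g\<close> with
  \<open>g = 1\<close> at 2 and -2, and \<open>g = -1/3\<close> at 0. Under \<open>tri 0 1\<close>
  the functions 1, \<open>x\<close>, \<open>g\<close> are orthogonal with second moments 1, 1,
  1/3.\<close>

lemma tri_correlation:
  "(\<Sum>x\<in>{-2, 0, 2}. tri \<mu> (1 + \<mu>\<^sup>2) x * tri \<nu> (1 + \<nu>\<^sup>2) x / tri 0 1 x) =
   1 + \<mu> * \<nu> + (\<mu> * \<nu>)\<^sup>2 / 3"
  by (simp add: tri_def field_simps power2_eq_square)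

section \<open>The three regimes\<close>

lemma power_one_plus_le_exp:
  fixes u :: real
  assumes "0 \<le> 1 + u"
  shows "(1 + u) ^ m \<le> exp (real m * u)"
proof -
  have "(1 + u) ^ m \<le> exp u ^ m"
    using assms exp_ge_add_one_self[of u] by (intro power_mono) (auto simp: add.commute)
  then show ?thesis by (simp add: exp_of_nat_mult)
qed

lemma tri_01_pos: "x \<in> {-2, 0, 2} \<Longrightarrow> 0 < tri 0 1 x"
  by (auto simp: tri_def)

text \<open>With amplitude \<open>sqrt (l / j)\<close> on \<open>j\<close> columns the squared
  signal in a row is \<open>l\<close> at every scale; two such profiles have inner product
  \<open>l\<close> times their overlap.\<close>

lemma min_mult_profile:
  assumes "0 \<le> l"
  shows "real (min j j') * (sqrt (l / real j) * sqrt (l / real j')) = l * overlap j j'"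
  using assms by (simp add: overlap_def real_sqrt_divide)

text \<open>Only row 1 jumps, always with sign 1, so the change point alone is random.\<close>

lemma minimax_loglog:
  assumes K: "0 < \<alpha>" "0 < K" "(3 / K) powr \<alpha> \<le> 1 / 4"
    and n: "2 \<le> n" and p: "1 \<le> p" and s: "1 \<le> s"
    and \<rho>: "\<rho>\<^sup>2 \<le> ln (ln (8 * real n)) / 1152"
  shows "1 / 2 \<le> minimax_error \<alpha> K p n s \<rho>"
proof -
  obtain E where E: "finite E" "E \<noteq> {}" "ln (8 * real n) \<le> 9 * real (card E)"
    and grid: "\<And>k. k \<in> E \<Longrightarrow> 2 * 4 ^ k \<le> n \<and> card E \<le> 4 ^ k"
    using exists_dyadic_grid[OF n] by blast
  define L where "L = ln (ln (8 * real n))"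
  \<comment> \<open>The chi-square exponent will be \<open>2 * l = L / 288\<close>, the most that
    \<open>sum_exp_overlap_le\<close> allows, and the detectable signal is
    \<open>l / 2 = L / 1152\<close>.\<close>
  define l where "l = L / 576"
  define J where "J = (\<lambda>k. 4 ^ k :: nat) ` E"
  define b where "b j = sqrt (l / real j)" for j :: nat
  define r where "r i a = (if i = (1 :: nat) then of_bool (a = 1) else of_bool (a = 0) :: real)"
    for i and a :: real
  have L: "0 \<le> L" "L \<le> 9 * real (card E)"
    using ln_ln_ge_0[OF n] E(3) by (simp_all add: L_def)
  have l: "0 \<le> l" using L by (simp add: l_def)
  have J: "1 \<le> j" "2 * j \<le> n" "l \<le> real j" if "j \<in> J" for j
  proof -
    obtain k where k: "k \<in> E" "j = 4 ^ k" using \<open>j \<in> J\<close> by (auto simp: J_def)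
    \<comment> \<open>The grid property enters here: \<open>l <= j\<close> gives
      \<open>b j <= 1\<close>, as the three-point laws require.\<close>
    have "real (card E) \<le> real j" using grid[OF k(1)] k(2) by simp
    then show "l \<le> real j" unfolding l_def using L by linarith
    show "1 \<le> j" "2 * j \<le> n" using grid[OF k(1)] k(2) by auto
  qed
  have b: "0 \<le> b j" "b j \<le> 1" "real j * (b j)\<^sup>2 = l" if "j \<in> J" for j
    using J[OF that] l by (auto simp: b_def)
  have card_J: "card J = card E" unfolding J_def by (intro card_image) (auto simp: inj_on_def)
  let ?S = "{-2, 0, 2} :: real set"
  show ?thesis
  proof (rule product_prior_lower_bound)
    show "finite ?S" "1 \<le> p" using p by auto
    show "finite J" "J \<noteq> {}" using E by (auto simp: J_def)
    show "1 \<le> j \<and> 2 * j \<le> n" if "j \<in> J" for j using J[OF that] by auto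
    show "noise_law \<alpha> K ?S 0 (tri 0 1)" using noise_law_tri[of ?S \<alpha> K 0] K by simp
    show "0 < tri 0 1 x" if "x \<in> ?S" for x using that by (rule tri_01_pos)
    show "noise_law \<alpha> K ?S (a * b j) (tri (a * b j) (1 + (a * b j)\<^sup>2))"
      if "j \<in> J" "a \<in> signs" for j a
      using that b[of j] by (intro noise_law_tri K) (auto simp: abs_mult)
    show "0 \<le> r i a" for i a by (simp add: r_def)
    show "(\<Sum>a\<in>signs. r i a) = 1" for i by (simp add: r_def)
    \<comment> \<open>The sign prior is a point mass at a vector that is good, so bad vectors have
      weight 0.\<close>
    have "(\<Prod>i\<in>{1..p}. r i (\<xi> i)) = 0"
      if \<xi>: "\<xi> \<in> {1..p} \<rightarrow>\<^sub>E signs" "\<not> (nnz p \<xi> \<le> s \<and>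
        (\<forall>j\<in>J. \<rho>\<^sup>2 \<le> real j * (b j)\<^sup>2 * real (nnz p \<xi>) / 2))" for \<xi>
    proof (rule ccontr)
      assume "(\<Prod>i\<in>{1..p}. r i (\<xi> i)) \<noteq> 0"
      then have *: "r i (\<xi> i) \<noteq> 0" if "i \<in> {1..p}" for i using that by auto
      have "\<xi> i = (if i = 1 then 1 else 0)" if "i \<in> {1..p}" for i
        using *[OF that] by (auto simp: r_def split: if_splits)
      then have "{i \<in> {1..p}. \<xi> i \<noteq> 0} = {1}" using p by (auto split: if_splits)
      then have "nnz p \<xi> = 1" by (simp add: nnz_def)
      then show False using \<xi>(2) s \<rho> b(3) by (auto simp: l_def L_def)
    qed
    then have "(\<Sum>\<xi> | \<xi> \<in> {1..p} \<rightarrow>\<^sub>E signs \<and> \<not> (nnz p \<xi> \<le> s \<and>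
        (\<forall>j\<in>J. \<rho>\<^sup>2 \<le> real j * (b j)\<^sup>2 * real (nnz p \<xi>) / 2)). \<Prod>i\<in>{1..p}. r i (\<xi> i)) = 0"
      by (intro sum.neutral) blast
    then show "(\<Sum>\<xi> | \<xi> \<in> {1..p} \<rightarrow>\<^sub>E signs \<and> \<not> (nnz p \<xi> \<le> s \<and>
        (\<forall>j\<in>J. \<rho>\<^sup>2 \<le> real j * (b j)\<^sup>2 * real (nnz p \<xi>) / 2)). \<Prod>i\<in>{1..p}. r i (\<xi> i)) \<le> 1 / 8"
      by simp
    have *: "(\<Prod>i\<in>{1..p}. \<Sum>a\<in>signs. \<Sum>a'\<in>signs. r i a * r i a' *
        (\<Sum>x\<in>?S. tri (a * b j) (1 + (a * b j)\<^sup>2) x * tri (a' * b j') (1 + (a' * b j')\<^sup>2) x / tri 0 1 x) ^ min j j')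
      \<le> exp (2 * l * overlap j j')" (is "?P \<le> _") if j: "j \<in> J" "j' \<in> J" for j j'
    proof -
      define y where "y = b j * b j'"
      have y: "0 \<le> y" "y \<le> 1"
        using b[OF j(1)] b[OF j(2)] by (auto simp: y_def intro: mult_le_one)
      define g where "g i = (\<Sum>a\<in>signs. \<Sum>a'\<in>signs. r i a * r i a' *
        (1 + a * b j * (a' * b j') + (a * b j * (a' * b j'))\<^sup>2 / 3) ^ min j j')" for i
      have "?P = (\<Prod>i\<in>{1..p}. g i)" unfolding g_def tri_correlation ..
      also have "\<dots> = g 1 * (\<Prod>i\<in>{1..p} - {1}. g i)"
        using p by (intro prod.remove) auto
      also have "(\<Prod>i\<in>{1..p} - {1}. g i) = 1"
        by (intro prod.neutral) (auto simp: g_def r_def)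
      also have "g 1 = (1 + (y + y\<^sup>2 / 3)) ^ min j j'"
        by (simp add: g_def r_def y_def add.assoc)
      also have "\<dots> \<le> exp (real (min j j') * (y + y\<^sup>2 / 3))"
        using y by (intro power_one_plus_le_exp) auto
      also have "\<dots> \<le> exp (real (min j j') * (2 * y))"
      proof -
        have "y\<^sup>2 \<le> y" using y by (simp add: power2_eq_square mult_left_le)
        then show ?thesis using y by (simp add: mult_left_mono)
      qed
      also have "real (min j j') * (2 * y) = 2 * l * overlap j j'"
        using min_mult_profile[OF l, of j j'] by (simp add: y_def b_def)
      finally show ?thesis by simp
    qed
    have "(\<Sum>j\<in>J. \<Sum>j'\<in>J. exp (2 * l * overlap j j')) \<le> 9 / 8 * (real (card J))\<^sup>2"
      unfolding card_J unfolding J_def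
      using L by (intro sum_exp_overlap_le[OF n E]) (auto simp: l_def L_def)
    then show "(\<Sum>j\<in>J. \<Sum>j'\<in>J. \<Prod>i\<in>{1..p}. \<Sum>a\<in>signs. \<Sum>a'\<in>signs. r i a * r i a' *
        (\<Sum>x\<in>?S. tri (a * b j) (1 + (a * b j)\<^sup>2) x * tri (a' * b j') (1 + (a' * b j')\<^sup>2) x / tri 0 1 x) ^ min j j')
      \<le> 9 / 8 * (real (card J))\<^sup>2"
      by (rule order.trans[rotated]) (intro sum_mono *)
  qed
qed

text \<open>Averaging over the sign of \<open>y\<close> cancels the linear term, leaving the square
  of \<open>m * y\<close>. The correction \<open>m * y^2 / 3\<close> is of that order too, because
  \<open>m >= 1\<close>.\<close>

lemma symmetrized_power_le:
  fixes y :: real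
  assumes m: "1 \<le> m" and y: "0 \<le> y" and my: "real m * y \<le> 1 / 4"
  shows "(1 + (y + y\<^sup>2 / 3)) ^ m + (1 + (- y + y\<^sup>2 / 3)) ^ m \<le> 2 + 4 * (real m * y)\<^sup>2"
proof -
  define a where "a = real m * y"
  define q where "q = real m * (y\<^sup>2 / 3)"
  have "real m * y\<^sup>2 \<le> (real m * real m) * y\<^sup>2"
    using m by (intro mult_right_mono) auto
  with y have q: "0 \<le> q" "q \<le> a\<^sup>2 / 3"
    by (auto simp: q_def a_def power2_eq_square mult_ac)
  have a: "0 \<le> a" "a \<le> 1 / 4" using y my by (auto simp: a_def)
  have "a\<^sup>2 \<le> 1" using a by (simp add: power_le_one)
  then have q1: "q \<le> 1 / 3" using q by linarith
  have "q\<^sup>2 \<le> q" using q q1 by (simp add: power2_eq_square mult_left_le)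
  \<comment> \<open>Dividing by 3 gives \<open>y^2 / 3 - y + 3/4 >= 0\<close>, so the base with the
    negative sign is nonnegative.\<close>
  have "0 \<le> (y - 3 / 2)\<^sup>2" by simp
  then have pos: "0 \<le> 1 + (- y + y\<^sup>2 / 3)" by (simp add: power2_eq_square algebra_simps)
  have "(1 + (y + y\<^sup>2 / 3)) ^ m + (1 + (- y + y\<^sup>2 / 3)) ^ m \<le>
      exp (real m * (y + y\<^sup>2 / 3)) + exp (real m * (- y + y\<^sup>2 / 3))"
    using y pos by (intro add_mono power_one_plus_le_exp) auto
  also have "\<dots> = exp (q + a) + exp (q - a)"
    by (simp add: q_def a_def algebra_simps)
  also have "\<dots> \<le> (1 + (q + a) + (q + a)\<^sup>2) + (1 + (q - a) + (q - a)\<^sup>2)"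
    using a q q1 by (intro add_mono exp_le_quadratic) auto
  also have "\<dots> = 2 + 2 * q + 2 * q\<^sup>2 + 2 * a\<^sup>2"
    by (simp add: power2_eq_square algebra_simps)
  also have "\<dots> \<le> 2 + 4 * a\<^sup>2" using q \<open>q\<^sup>2 \<le> q\<close> by linarith
  finally show ?thesis by (simp add: a_def)
qed

lemma minimax_dense:
  assumes K: "0 < \<alpha>" "0 < K" "(3 / K) powr \<alpha> \<le> 1 / 4"
    and n: "2 \<le> n" and s: "512 \<le> s" "s \<le> p"
    and dense: "sqrt (real p * ln (ln (8 * real n))) \<le> real s"
    and \<rho>: "\<rho>\<^sup>2 \<le> sqrt (real p * ln (ln (8 * real n))) / 256"
  shows "1 / 2 \<le> minimax_error \<alpha> K p n s \<rho>"
proof -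
  obtain E where E: "finite E" "E \<noteq> {}" "ln (8 * real n) \<le> 9 * real (card E)"
    and grid: "\<And>k. k \<in> E \<Longrightarrow> 2 * 4 ^ k \<le> n \<and> card E \<le> 4 ^ k"
    using exists_dyadic_grid[OF n] by blast
  define L where "L = ln (ln (8 * real n))"
  \<comment> \<open>The squared signal per active row. Density gives \<open>l <= 1/4\<close>, the
    range of \<open>symmetrized_power_le\<close>; \<open>s / 32\<close> active rows yield total
    signal at least \<open>sqrt (p * L) / 128\<close>.\<close>
  define l where "l = sqrt (real p * L) / (4 * real s)"
  define \<epsilon> where "\<epsilon> = real s / (8 * real p)"
  define J where "J = (\<lambda>k. 4 ^ k :: nat) ` E"
  define b where "b j = sqrt (l / real j)" for j :: nat
  define r where "r = sparse_weight \<epsilon>"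
  have sp: "0 < real s" "0 < real p" using s by auto
  have \<epsilon>: "0 \<le> \<epsilon>" "\<epsilon> \<le> 1" using s by (auto simp: \<epsilon>_def field_simps)
  have L: "0 \<le> L"
    using ln_ln_ge_0[OF n] E(3) by (simp_all add: L_def)
  have l: "0 \<le> l" "l \<le> 1 / 4" using L dense sp by (auto simp: l_def L_def field_simps)
  have J: "1 \<le> j" "2 * j \<le> n" if "j \<in> J" for j
    using that grid by (auto simp: J_def)
  have b: "0 \<le> b j" "b j \<le> 1" "real j * (b j)\<^sup>2 = l" if "j \<in> J" for j
    using J[OF that] l by (auto simp: b_def)
  have card_J: "card J = card E" unfolding J_def by (intro card_image) (auto simp: inj_on_def)
  let ?S = "{-2, 0, 2} :: real set"
  show ?thesis
  proof (rule product_prior_lower_bound)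
    show "finite ?S" "1 \<le> p" using s by auto
    show "finite J" "J \<noteq> {}" using E by (auto simp: J_def)
    show "1 \<le> j \<and> 2 * j \<le> n" if "j \<in> J" for j using J[OF that] by auto
    show "noise_law \<alpha> K ?S 0 (tri 0 1)" using noise_law_tri[of ?S \<alpha> K 0] K by simp
    show "0 < tri 0 1 x" if "x \<in> ?S" for x using that by (rule tri_01_pos)
    show "noise_law \<alpha> K ?S (a * b j) (tri (a * b j) (1 + (a * b j)\<^sup>2))"
      if "j \<in> J" "a \<in> signs" for j a
      using that b[of j] by (intro noise_law_tri K) (auto simp: abs_mult)
    show "0 \<le> r a" for a unfolding r_def using \<epsilon> by (rule sparse_weight_nonneg)
    show "(\<Sum>a\<in>signs. r a) = 1" unfolding r_def by (rule sum_sparse_weight)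
    show "(\<Sum>\<xi> | \<xi> \<in> {1..p} \<rightarrow>\<^sub>E signs \<and> \<not> (nnz p \<xi> \<le> s \<and>
        (\<forall>j\<in>J. \<rho>\<^sup>2 \<le> real j * (b j)\<^sup>2 * real (nnz p \<xi>) / 2)). \<Prod>i\<in>{1..p}. r (\<xi> i)) \<le> 1 / 8"
      unfolding r_def
    proof (rule nnz_concentration[OF s \<epsilon>_def], intro conjI ballI)
      fix \<xi> j assume \<xi>: "nnz p \<xi> \<le> s" "real s / 32 \<le> real (nnz p \<xi>)" and "j \<in> J"
      have "\<rho>\<^sup>2 \<le> l * (real s / 32) / 2"
        using \<rho> sp by (simp add: l_def L_def)
      also have "\<dots> \<le> l * real (nnz p \<xi>) / 2"
        using \<xi>(2) l by (intro divide_right_mono mult_left_mono) auto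
      finally show "\<rho>\<^sup>2 \<le> real j * (b j)\<^sup>2 * real (nnz p \<xi>) / 2"
        using b(3)[OF \<open>j \<in> J\<close>] by simp
    qed
    have *: "(\<Prod>i\<in>{1..p}. \<Sum>a\<in>signs. \<Sum>a'\<in>signs. r a * r a' *
        (\<Sum>x\<in>?S. tri (a * b j) (1 + (a * b j)\<^sup>2) x * tri (a' * b j') (1 + (a' * b j')\<^sup>2) x / tri 0 1 x) ^ min j j')
      \<le> exp (L / 512 * overlap j j')" (is "?P \<le> _") if j: "j \<in> J" "j' \<in> J" for j j'
    proof -
      define y where "y = b j * b j'"
      define a where "a = real (min j j') * y"
      have y: "0 \<le> y" using b[OF j(1)] b[OF j(2)] by (auto simp: y_def)
      have a_eq: "a = l * overlap j j'"
        unfolding a_def y_def b_def by (rule min_mult_profile[OF l(1)])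
      have "a \<le> l" using a_eq l overlap_le_1[of j j'] by (simp add: mult_left_le)
      define f where "f z = (1 + (z * y + (z * y)\<^sup>2 / 3)) ^ min j j'" for z
      have f: "(\<Sum>x\<in>?S. tri (c * b j) (1 + (c * b j)\<^sup>2) x * tri (c' * b j') (1 + (c' * b j')\<^sup>2) x / tri 0 1 x) ^ min j j'
          = f (c * c')" for c c'
        unfolding tri_correlation by (simp add: f_def y_def add.assoc mult_ac)
      have "f 0 = 1" by (simp add: f_def)
      have "f 1 + f (- 1) \<le> 2 + 4 * a\<^sup>2"
        unfolding f_def a_def using y J[OF j(1)] J[OF j(2)] \<open>a \<le> l\<close> l
        using symmetrized_power_le[of "min j j'" y] by (simp add: a_def)
      then have "\<epsilon>\<^sup>2 / 2 * (f 1 + f (- 1)) \<le> \<epsilon>\<^sup>2 / 2 * (2 + 4 * a\<^sup>2)"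
        by (intro mult_left_mono) auto
      \<comment> \<open>Two independent draws are both active in a row with probability
        \<open>\<epsilon>^2\<close>, and then the product of their signs is fair; otherwise the
        factor is 1.\<close>
      moreover have G: "(\<Sum>c\<in>signs. \<Sum>c'\<in>signs. r c * r c' * f (c * c')) =
          1 - \<epsilon>\<^sup>2 + \<epsilon>\<^sup>2 / 2 * (f 1 + f (- 1))"
        using \<open>f 0 = 1\<close> by (simp add: r_def sparse_weight_def field_simps power2_eq_square)
      moreover have "\<epsilon>\<^sup>2 / 2 * (2 + 4 * a\<^sup>2) = \<epsilon>\<^sup>2 + 2 * \<epsilon>\<^sup>2 * a\<^sup>2"
        by (simp add: algebra_simps)
      ultimately have G_le: "(\<Sum>c\<in>signs. \<Sum>c'\<in>signs. r c * r c' * f (c * c')) \<le> 1 + 2 * \<epsilon>\<^sup>2 * a\<^sup>2"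
        by linarith
      have f_nn: "0 \<le> f z" for z
      proof -
        have "0 \<le> (z * y + 3 / 2)\<^sup>2" by simp
        then have "0 \<le> 1 + (z * y + (z * y)\<^sup>2 / 3)"
          by (simp add: power2_eq_square algebra_simps)
        then show ?thesis by (simp add: f_def)
      qed
      have r_nn: "0 \<le> r c" for c unfolding r_def using \<epsilon> by (rule sparse_weight_nonneg)
      have "?P = (\<Sum>c\<in>signs. \<Sum>c'\<in>signs. r c * r c' * f (c * c')) ^ p"
        unfolding f by simp
      also have "\<dots> \<le> (1 + 2 * \<epsilon>\<^sup>2 * a\<^sup>2) ^ p"
        by (intro power_mono G_le sum_nonneg mult_nonneg_nonneg r_nn f_nn)
      also have "\<dots> \<le> exp (real p * (2 * \<epsilon>\<^sup>2 * a\<^sup>2))"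
        by (intro power_one_plus_le_exp) auto
      also have "\<dots> \<le> exp (L / 512 * overlap j j')"
      proof -
        have "real p * (2 * \<epsilon>\<^sup>2 * a\<^sup>2) = (real p * 2 * \<epsilon>\<^sup>2 * l\<^sup>2) * (overlap j j')\<^sup>2"
          by (simp add: a_eq power_mult_distrib)
        \<comment> \<open>\<open>2 * p * (s / (8 * p))^2 * (p * L) / (4 * s)^2 = L / 512\<close>,
          within the admissible \<open>L / 288\<close>.\<close>
        also have "real p * 2 * \<epsilon>\<^sup>2 * l\<^sup>2 = L / 512"
          using sp L by (simp add: \<epsilon>_def l_def power_divide power_mult_distrib power2_eq_square[of "real p"])
        also have "L / 512 * (overlap j j')\<^sup>2 \<le> L / 512 * overlap j j'"
          using L overlap_nonneg[of j j'] overlap_le_1[of j j']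
          by (intro mult_left_mono) (auto simp: power2_eq_square mult_left_le)
        finally show ?thesis by simp
      qed
      finally show ?thesis .
    qed
    have "(\<Sum>j\<in>J. \<Sum>j'\<in>J. exp (L / 512 * overlap j j')) \<le> 9 / 8 * (real (card J))\<^sup>2"
      unfolding card_J unfolding J_def
      using L by (intro sum_exp_overlap_le[OF n E]) (auto simp: L_def)
    then show "(\<Sum>j\<in>J. \<Sum>j'\<in>J. \<Prod>i\<in>{1..p}. \<Sum>a\<in>signs. \<Sum>a'\<in>signs. r a * r a' *
        (\<Sum>x\<in>?S. tri (a * b j) (1 + (a * b j)\<^sup>2) x * tri (a' * b j') (1 + (a' * b j')\<^sup>2) x / tri 0 1 x) ^ min j j')
      \<le> 9 / 8 * (real (card J))\<^sup>2"
      by (rule order.trans[rotated]) (intro sum_mono *)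
  qed
qed


section \<open>Large jumps in one column, hidden in a null law with far atoms\<close>

definition two :: "real \<Rightarrow> real \<Rightarrow> real" where
  "two c x = 1 / 2 * of_bool (x = c + 1) + 1 / 2 * of_bool (x = c - 1)"

lemma two_nonneg: "0 \<le> two c x"
  by (simp add: two_def)

lemma sum_two:
  assumes "finite S" "c + 1 \<in> S" "c - 1 \<in> S"
  shows "(\<Sum>x\<in>S. two c x * g x) = (g (c + 1) + g (c - 1)) / 2"
  using assms by (simp only: two_def distrib_right sum.distrib) (simp only: sum_of_bool_eq_mult, simp add: add_divide_distrib)

text \<open>The noise is exactly a fair sign whatever the centre is, so the mean may be far out,
  beyond the reach of \<open>tri\<close>.\<close>

lemma noise_law_two:
  assumes S: "finite S" "c + 1 \<in> S" "c - 1 \<in> S"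
    and K: "0 < \<alpha>" "0 < K" "(3 / K) powr \<alpha> \<le> 1 / 4"
  shows "noise_law \<alpha> K S c (two c)"
proof -
  have "exp (\<bar>(c + 1 - c) / K\<bar> powr \<alpha>) \<le> 21 / 16" "exp (\<bar>(c - 1 - c) / K\<bar> powr \<alpha>) \<le> 21 / 16"
    by (intro exp_powr_le K; simp)+
  then have "(\<Sum>x\<in>S. two c x * exp (\<bar>(x - c) / K\<bar> powr \<alpha>)) \<le> 2"
    unfolding sum_two[OF S] by simp
  then show ?thesis
    using sum_two[OF S, of "\<lambda>_. 1"] sum_two[OF S, of "\<lambda>x. x - c"] sum_two[OF S, of "\<lambda>x. (x - c)\<^sup>2"]
    by (simp add: noise_law_def two_nonneg)
qed

lemma tri_chi_square:
  assumes "0 \<le> \<delta>" "\<delta> \<le> 1 / 2"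
  shows "(\<Sum>x\<in>{-2, 0, 2}. (tri 0 1 x - tri 0 (1 - \<delta>) x)\<^sup>2 / tri 0 (1 - \<delta>) x) \<le> \<delta>\<^sup>2"
proof -
  have "(\<Sum>x\<in>{-2, 0, 2}. (tri 0 1 x - tri 0 (1 - \<delta>) x)\<^sup>2 / tri 0 (1 - \<delta>) x) =
      2 * ((\<delta> / 8)\<^sup>2 / ((1 - \<delta>) / 8)) + (\<delta> / 4)\<^sup>2 / ((3 + \<delta>) / 4)"
  proof -
    have sum3: "(\<Sum>x\<in>{-2, 0, 2}. g x) = g (-2) + g 0 + g 2" for g :: "real \<Rightarrow> real"
      by simp
    have diff: "tri 0 1 2 - tri 0 (1 - \<delta>) 2 = \<delta> / 8" "tri 0 1 (-2) - tri 0 (1 - \<delta>) (-2) = \<delta> / 8"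
      "tri 0 1 0 - tri 0 (1 - \<delta>) 0 = - (\<delta> / 4)"
      by (simp_all add: tri_def field_simps)
    have val: "tri 0 (1 - \<delta>) 2 = (1 - \<delta>) / 8" "tri 0 (1 - \<delta>) (-2) = (1 - \<delta>) / 8"
      "tri 0 (1 - \<delta>) 0 = (3 + \<delta>) / 4"
      by (simp_all add: tri_def field_simps)
    show ?thesis unfolding sum3 diff unfolding val by simp
  qed
  also have "\<dots> \<le> 2 * ((\<delta> / 8)\<^sup>2 / (1 / 16)) + (\<delta> / 4)\<^sup>2 / (1 / 8)"
    using assms by (intro add_mono mult_left_mono divide_left_mono) auto
  also have "\<dots> = \<delta>\<^sup>2" by (simp add: power2_eq_square)
  finally show ?thesis .
qed

text \<open>Only the component \<open>c * A\<close> of the mixture \<open>Q\<close> is replaced, by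
  \<open>c * B\<close>. The linear term vanishes because both have mass 1, and
  \<open>c * A <= Q\<close> allows comparing with the divergence of \<open>B\<close> from
  \<open>A\<close> alone.\<close>

lemma chi_square_mixture:
  fixes Q A B :: "real \<Rightarrow> real"
  assumes S: "finite S" "T \<subseteq> S"
    and A: "\<And>x. x \<in> S - T \<Longrightarrow> A x = 0 \<and> B x = 0" "\<And>x. x \<in> T \<Longrightarrow> 0 < A x"
    and c: "0 < c" "c \<le> 1" and AB: "(\<Sum>x\<in>S. A x) = 1" "(\<Sum>x\<in>S. B x) = 1"
    and Q: "\<And>x. x \<in> S \<Longrightarrow> 0 < Q x" "\<And>x. x \<in> S \<Longrightarrow> c * A x \<le> Q x" "(\<Sum>x\<in>S. Q x) = 1"
  shows "(\<Sum>x\<in>S. (Q x + c * (B x - A x))\<^sup>2 / Q x) \<le> 1 + (\<Sum>x\<in>T. (B x - A x)\<^sup>2 / A x)"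
proof -
  have "(\<Sum>x\<in>S. (Q x + c * (B x - A x))\<^sup>2 / Q x) =
      (\<Sum>x\<in>S. Q x + 2 * c * (B x - A x) + (c * (B x - A x))\<^sup>2 / Q x)"
  proof (intro sum.cong refl)
    fix x assume "x \<in> S"
    then have "0 < Q x" by (rule Q)
    then show "(Q x + c * (B x - A x))\<^sup>2 / Q x = Q x + 2 * c * (B x - A x) + (c * (B x - A x))\<^sup>2 / Q x"
      by (simp add: power2_sum add_divide_distrib) (simp add: power2_eq_square)
  qed
  also have "\<dots> = 1 + 2 * c * (\<Sum>x\<in>S. B x - A x) + (\<Sum>x\<in>S. (c * (B x - A x))\<^sup>2 / Q x)"
    using Q(3) by (simp only: sum.distrib sum_distrib_left)
  also have "(\<Sum>x\<in>S. B x - A x) = 0" using AB by (simp add: sum_subtractf)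
  also have "(\<Sum>x\<in>S. (c * (B x - A x))\<^sup>2 / Q x) = (\<Sum>x\<in>T. (c * (B x - A x))\<^sup>2 / Q x)"
    using S A by (intro sum.mono_neutral_right) auto
  also have "\<dots> \<le> (\<Sum>x\<in>T. (B x - A x)\<^sup>2 / A x)"
  proof (rule sum_mono)
    fix x assume x: "x \<in> T"
    have "(c * (B x - A x))\<^sup>2 / Q x \<le> (c * (B x - A x))\<^sup>2 / (c * A x)"
      using x S A(2)[OF x] Q(1,2)[of x] c by (intro divide_left_mono) auto
    also have "\<dots> = c * ((B x - A x)\<^sup>2 / A x)"
      using c by (simp add: power_mult_distrib power2_eq_square)
    also have "\<dots> \<le> 1 * ((B x - A x)\<^sup>2 / A x)"
      using c A(2)[OF x] by (intro mult_right_mono) auto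
    finally show "(c * (B x - A x))\<^sup>2 / Q x \<le> (B x - A x)\<^sup>2 / A x" by simp
  qed
  finally show ?thesis by simp
qed

lemma minimax_sparse:
  assumes K: "0 < \<alpha>" "0 < K" "(3 / K) powr \<alpha> \<le> 1 / 4"
    and n: "2 \<le> n" and s: "512 \<le> s" "s \<le> p"
    and \<rho>: "\<rho>\<^sup>2 \<le> min (real s * ln (exp 1 * real p / real s) powr (2 / \<alpha>)) (sqrt (real p)) / 128"
  shows "1 / 2 \<le> minimax_error \<alpha> K p n s \<rho>"
proof -
  define L where "L = ln (exp 1 * real p / real s)"
  \<comment> \<open>The first cap gives \<open>d <= L powr (1 / \<alpha>)\<close>, for the tail
    condition; the second gives \<open>p * \<delta>^2 <= 1/64\<close>, for the chi-square
    bound.\<close>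
  define l where "l = min (L powr (2 / \<alpha>)) (sqrt (real p) / (2 * real s))"
  define d where "d = sqrt l"
  define \<epsilon> where "\<epsilon> = real s / (8 * real p)"
  \<comment> \<open>Chosen so that \<open>(1 - \<epsilon>) * \<delta> = \<epsilon> * l\<close>: the
    shrunken centre offsets the excess variance of the far atoms.\<close>
  define \<delta> where "\<delta> = \<epsilon> * l / (1 - \<epsilon>)"
  define r where "r = sparse_weight \<epsilon>"
  \<comment> \<open>Points coincide for special \<open>d\<close>, such as \<open>d = 1\<close>. The
    laws are sums of point indicators, so weights at coinciding atoms simply add.\<close>
  define S where "S = {-2, 0, 2, d + 1, d - 1, - d + 1, - d - 1}"
  define Q where "Q x = (1 - \<epsilon>) * tri 0 (1 - \<delta>) x + \<epsilon> / 2 * two d x + \<epsilon> / 2 * two (- d) x" for x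
  define h where "h a = (if a = 0 then tri 0 1 else two (a * d))" for a :: real
  have sp: "0 < real s" "0 < real p" "real s \<le> real p" using s by auto
  have \<epsilon>: "0 < \<epsilon>" "\<epsilon> \<le> 1 / 8" using sp by (auto simp: \<epsilon>_def field_simps)
  have \<epsilon>01: "0 \<le> \<epsilon>" "\<epsilon> \<le> 1" using \<epsilon> by auto
  have L: "1 \<le> L"
  proof -
    have "exp 1 \<le> exp 1 * real p / real s" using sp by (simp add: field_simps)
    then show ?thesis unfolding L_def using sp by (subst ln_ge_iff) auto
  qed
  have l: "0 \<le> l" using sp by (simp add: l_def)
  have d: "0 \<le> d" "d\<^sup>2 = l" using l by (auto simp: d_def)
  have d_le: "d \<le> L powr (1 / \<alpha>)"
  proof -
    have "l \<le> L powr (2 / \<alpha>)" by (simp add: l_def)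
    also have "\<dots> = (L powr (1 / \<alpha>))\<^sup>2"
      by (simp add: power2_eq_square flip: powr_add)
    finally show ?thesis unfolding d_def by (intro real_le_lsqrt) auto
  qed
  have \<delta>: "0 \<le> \<delta>" "\<delta> \<le> 1 / (8 * sqrt (real p))"
  proof -
    show "0 \<le> \<delta>" using \<epsilon> l by (simp add: \<delta>_def)
    have "\<delta> \<le> \<epsilon> * l / (1 / 2)"
      unfolding \<delta>_def using \<epsilon> l by (intro divide_left_mono) auto
    also have "\<dots> \<le> \<epsilon> * (sqrt (real p) / (2 * real s)) / (1 / 2)"
      using \<epsilon> by (intro divide_right_mono mult_left_mono) (auto simp: l_def)
    also have "\<dots> = sqrt (real p) / (8 * real p)" using sp by (simp add: \<epsilon>_def)
    also have "\<dots> = 1 / (8 * sqrt (real p))" using sp by (simp add: field_simps)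
    finally show "\<delta> \<le> 1 / (8 * sqrt (real p))" .
  qed
  have p\<delta>: "real p * \<delta>\<^sup>2 \<le> 1 / 64"
  proof -
    have "\<delta>\<^sup>2 \<le> (1 / (8 * sqrt (real p)))\<^sup>2" using \<delta> by (intro power_mono)
    then show ?thesis using sp by (simp add: power_divide power_mult_distrib field_simps)
  qed
  have \<delta>_half: "\<delta> \<le> 1 / 2"
  proof -
    have "1 / (8 * sqrt (real p)) \<le> 1 / (8 * 1)"
      using sp s by (intro divide_left_mono mult_left_mono) auto
    then show ?thesis using \<delta> by simp
  qed
  have finS: "finite S" and S3: "{-2, 0, 2} \<subseteq> S" by (auto simp: S_def)
  have S_two: "d + 1 \<in> S" "d - 1 \<in> S" "- d + 1 \<in> S" "- d - 1 \<in> S" by (auto simp: S_def)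
  have tri_nn: "0 \<le> tri 0 (1 - \<delta>) x" for x using \<delta> \<delta>_half by (intro tri_nonneg) auto
  have tri_pos: "0 < tri 0 (1 - \<delta>) x" if "x \<in> {-2, 0, 2}" for x
    using that \<delta> \<delta>_half by (auto simp: tri_def)
  have sum_Q: "(\<Sum>x\<in>S. Q x * g x) = (1 - \<epsilon>) * ((1 - \<delta>) / 8 * g 2 + (1 - \<delta>) / 8 * g (-2) + (1 - (1 - \<delta>) / 4) * g 0)
      + \<epsilon> / 4 * (g (d + 1) + g (d - 1) + g (- d + 1) + g (- d - 1))" for g
  proof -
    have "(\<Sum>x\<in>S. Q x * g x) = (1 - \<epsilon>) * (\<Sum>x\<in>S. tri 0 (1 - \<delta>) x * g x) +
        \<epsilon> / 2 * (\<Sum>x\<in>S. two d x * g x) + \<epsilon> / 2 * (\<Sum>x\<in>S. two (- d) x * g x)"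
      by (simp only: Q_def distrib_right sum.distrib sum_distrib_left mult.assoc)
    then show ?thesis
      unfolding sum_tri[OF finS S3] sum_two[OF finS S_two(1,2)] sum_two[OF finS S_two(3,4)]
      by (simp add: field_simps)
  qed
  have Q_pos: "0 < Q x" if "x \<in> S" for x
  proof (cases "x \<in> {-2, 0, 2}")
    case True
    then have "0 < (1 - \<epsilon>) * tri 0 (1 - \<delta>) x" using tri_pos \<epsilon> by simp
    then show ?thesis unfolding Q_def using \<epsilon> by (intro add_pos_nonneg) (auto simp: two_nonneg)
  next
    case False
    then have "0 < two d x + two (- d) x" using that by (auto simp: S_def two_def)
    then have "0 < \<epsilon> / 2 * (two d x + two (- d) x)" using \<epsilon> by simp
    moreover have "0 \<le> (1 - \<epsilon>) * tri 0 (1 - \<delta>) x" using tri_nn \<epsilon> by simp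
    ultimately show ?thesis unfolding Q_def by (simp add: distrib_left)
  qed
  have big: "exp (\<bar>y / K\<bar> powr \<alpha>) \<le> exp L" if "\<bar>y\<bar> \<le> d + 1" for y
  proof -
    have "1 \<le> L powr (1 / \<alpha>)" using L K by (simp add: ge_one_powr_ge_zero)
    then have "\<bar>y\<bar> \<le> 3 * L powr (1 / \<alpha>)" using that d_le by linarith
    then have "\<bar>y / K\<bar> \<le> 3 / K * L powr (1 / \<alpha>)"
      using K by (simp add: abs_div field_simps)
    then have "\<bar>y / K\<bar> powr \<alpha> \<le> (3 / K * L powr (1 / \<alpha>)) powr \<alpha>"
      using K by (intro powr_mono2) auto
    also have "\<dots> = (3 / K) powr \<alpha> * L"
      by (subst powr_mult) (use K L in \<open>simp_all add: powr_powr\<close>)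
    also have "\<dots> \<le> 1 * L" using K L by (intro mult_right_mono) auto
    finally show ?thesis by simp
  qed
  have noise_Q: "noise_law \<alpha> K S 0 Q"
  proof -
    have \<epsilon>\<delta>: "(1 - \<epsilon>) * \<delta> = \<epsilon> * l" using \<epsilon> by (simp add: \<delta>_def)
    have 1: "(\<Sum>x\<in>S. Q x) = 1"
      using sum_Q[of "\<lambda>_. 1"] by (simp add: field_simps)
    have 2: "(\<Sum>x\<in>S. Q x * (x - 0)) = 0"
      unfolding sum_Q by (simp add: field_simps)
    have "(\<Sum>x\<in>S. Q x * (x - 0)\<^sup>2) = (1 - \<epsilon>) * (1 - \<delta>) + \<epsilon> * (l + 1)"
      unfolding sum_Q d(2)[symmetric] by (simp add: power2_eq_square field_simps)
    also have "\<dots> = 1 - (1 - \<epsilon>) * \<delta> + \<epsilon> * l" by (simp add: algebra_simps)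
    also have "\<dots> = 1" using \<epsilon>\<delta> by simp
    finally have 3: "(\<Sum>x\<in>S. Q x * (x - 0)\<^sup>2) = 1" .
    let ?e = "\<lambda>x. exp (\<bar>(x - 0) / K\<bar> powr \<alpha>)"
    have "(\<Sum>x\<in>S. Q x * ?e x) \<le>
      (1 - \<epsilon>) * ((1 - \<delta>) / 8 * (21 / 16) + (1 - \<delta>) / 8 * (21 / 16) + (1 - (1 - \<delta>) / 4) * (21 / 16))
      + \<epsilon> / 4 * (exp L + exp L + exp L + exp L)"
      unfolding sum_Q using \<epsilon> \<delta> \<delta>_half d
      by (intro add_mono mult_left_mono exp_powr_le[OF K] big) auto
    also have "\<dots> = (1 - \<epsilon>) * (21 / 16) + \<epsilon> * exp L" by (simp add: field_simps)
    \<comment> \<open>\<open>exp L = e * p / s\<close> matches the mass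
      \<open>\<epsilon> = s / (8 * p)\<close> of the far atoms; this balance produces the factor
      \<open>ln (e * p / s)\<close>.\<close>
    also have "\<epsilon> * exp L = exp 1 / 8"
      using sp by (simp add: \<epsilon>_def L_def)
    also have "(1 - \<epsilon>) * (21 / 16) + exp 1 / 8 \<le> 1 * (21 / 16) + 3 / 8"
      using \<epsilon> exp_le by (intro add_mono mult_right_mono divide_right_mono) auto
    also have "\<dots> \<le> 2" by simp
    finally have 4: "(\<Sum>x\<in>S. Q x * ?e x) \<le> 2" .
    show ?thesis using 1 2 3 4 Q_pos by (auto simp: noise_law_def less_imp_le)
  qed
  show ?thesis
  proof (rule product_prior_lower_bound)
    show "finite S" "1 \<le> p" using s by (auto simp: finS)
    \<comment> \<open>The change point is fixed at 1, so each active row carries its whole jump in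
      one entry.\<close>
    show "finite {1 :: nat}" "{1 :: nat} \<noteq> {}" by auto
    show "1 \<le> j \<and> 2 * j \<le> n" if "j \<in> {1}" for j using that n by auto
    show "noise_law \<alpha> K S 0 Q" by (rule noise_Q)
    show "0 < Q x" if "x \<in> S" for x using that by (rule Q_pos)
    show "noise_law \<alpha> K S (a * d) (h a)" if "j \<in> {1 :: nat}" "a \<in> signs" for j a
    proof (cases "a = 0")
      case True
      then show ?thesis using noise_law_tri[OF finS S3 K, of 0] by (simp add: h_def)
    next
      case False
      then have "noise_law \<alpha> K S (a * d) (two (a * d))"
        using that S_two by (intro noise_law_two finS K) auto
      then show ?thesis using False by (simp add: h_def)
    qed
    show "0 \<le> r a" for a unfolding r_def using \<epsilon>01 by (rule sparse_weight_nonneg)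
    show "(\<Sum>a\<in>signs. r a) = 1" unfolding r_def by (rule sum_sparse_weight)
    show "(\<Sum>\<xi> | \<xi> \<in> {1..p} \<rightarrow>\<^sub>E signs \<and> \<not> (nnz p \<xi> \<le> s \<and>
        (\<forall>j\<in>{1 :: nat}. \<rho>\<^sup>2 \<le> real j * d\<^sup>2 * real (nnz p \<xi>) / 2)). \<Prod>i\<in>{1..p}. r (\<xi> i)) \<le> 1 / 8"
      unfolding r_def
    proof (rule nnz_concentration[OF s \<epsilon>_def], intro conjI ballI)
      fix \<xi> and j :: nat assume \<xi>: "nnz p \<xi> \<le> s" "real s / 32 \<le> real (nnz p \<xi>)" and "j \<in> {1}"
      have "min (real s * L powr (2 / \<alpha>)) (sqrt (real p)) / 128 \<le> l * (real s / 32) / 2"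
      proof (cases "L powr (2 / \<alpha>) \<le> sqrt (real p) / (2 * real s)")
        case True
        have "min (real s * L powr (2 / \<alpha>)) (sqrt (real p)) / 128 \<le> 2 * (real s * L powr (2 / \<alpha>)) / 128"
          by (intro divide_right_mono min.coboundedI1) auto
        then show ?thesis using True by (simp add: l_def min_def mult_ac)
      next
        case False
        then have "l * (real s / 32) / 2 = sqrt (real p) / 128" using sp by (simp add: l_def)
        then show ?thesis by simp
      qed
      then have "\<rho>\<^sup>2 \<le> l * (real s / 32) / 2"
        using \<rho> unfolding L_def by linarith
      also have "\<dots> \<le> l * real (nnz p \<xi>) / 2"
        using \<xi>(2) l by (intro divide_right_mono mult_left_mono) auto
      finally show "\<rho>\<^sup>2 \<le> real j * d\<^sup>2 * real (nnz p \<xi>) / 2"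
        using \<open>j \<in> {1}\<close> by (simp add: d)
    qed
    \<comment> \<open>The far atoms cancel: averaging over the signs merely replaces the centre
      \<open>tri 0 (1 - \<delta>)\<close> of \<open>Q\<close> by \<open>tri 0 1\<close>.\<close>
    have mix: "(\<Sum>a\<in>signs. r a * h a x) = Q x + (1 - \<epsilon>) * (tri 0 1 x - tri 0 (1 - \<delta>) x)" for x
      by (simp add: r_def sparse_weight_def h_def Q_def algebra_simps)
    have "(\<Sum>a\<in>signs. \<Sum>a'\<in>signs. r a * r a' * (\<Sum>x\<in>S. h a x * h a' x / Q x)) =
        (\<Sum>a\<in>signs. \<Sum>a'\<in>signs. \<Sum>x\<in>S. (r a * h a x) * (r a' * h a' x) / Q x)"
      by (simp only: sum_distrib_left times_divide_eq_right mult_ac)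
    also have "\<dots> = (\<Sum>x\<in>S. \<Sum>a\<in>signs. \<Sum>a'\<in>signs. (r a * h a x) * (r a' * h a' x) / Q x)"
      by (subst (2) sum.swap, subst sum.swap) (rule refl)
    also have "\<dots> = (\<Sum>x\<in>S. (\<Sum>a\<in>signs. r a * h a x)\<^sup>2 / Q x)"
      unfolding power2_eq_square sum_product sum_divide_distrib ..
    finally have G: "(\<Sum>a\<in>signs. \<Sum>a'\<in>signs. r a * r a' * (\<Sum>x\<in>S. h a x * h a' x / Q x)) =
        (\<Sum>x\<in>S. (Q x + (1 - \<epsilon>) * (tri 0 1 x - tri 0 (1 - \<delta>) x))\<^sup>2 / Q x)"
      unfolding mix .
    have "(\<Sum>x\<in>S. (Q x + (1 - \<epsilon>) * (tri 0 1 x - tri 0 (1 - \<delta>) x))\<^sup>2 / Q x) \<le>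
        1 + (\<Sum>x\<in>{-2, 0, 2}. (tri 0 1 x - tri 0 (1 - \<delta>) x)\<^sup>2 / tri 0 (1 - \<delta>) x)"
    proof (rule chi_square_mixture[OF finS S3])
      show "tri 0 (1 - \<delta>) x = 0 \<and> tri 0 1 x = 0" if "x \<in> S - {-2, 0, 2}" for x
        using that by (auto simp: tri_def)
      show "(\<Sum>x\<in>S. tri 0 (1 - \<delta>) x) = 1" "(\<Sum>x\<in>S. tri 0 1 x) = 1"
        using sum_tri[OF finS S3, of _ _ "\<lambda>_. 1"] by (simp_all add: field_simps)
      show "(1 - \<epsilon>) * tri 0 (1 - \<delta>) x \<le> Q x" for x
        using \<epsilon> by (simp add: Q_def two_nonneg)
      show "(\<Sum>x\<in>S. Q x) = 1" using noise_Q by (simp add: noise_law_def)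
    qed (use \<epsilon> tri_pos Q_pos in auto)
    also have "\<dots> \<le> 1 + \<delta>\<^sup>2" using tri_chi_square[OF \<delta>(1) \<delta>_half] by simp
    finally have G_le: "(\<Sum>x\<in>S. (Q x + (1 - \<epsilon>) * (tri 0 1 x - tri 0 (1 - \<delta>) x))\<^sup>2 / Q x) \<le> 1 + \<delta>\<^sup>2" .
    have "(\<Sum>x\<in>S. (Q x + (1 - \<epsilon>) * (tri 0 1 x - tri 0 (1 - \<delta>) x))\<^sup>2 / Q x) ^ p \<le> (1 + \<delta>\<^sup>2) ^ p"
      using Q_pos by (intro power_mono G_le sum_nonneg divide_nonneg_pos) auto
    also have "\<dots> \<le> exp (real p * \<delta>\<^sup>2)"
      by (intro power_one_plus_le_exp) auto
    also have "\<dots> \<le> exp (1 / 64)" using p\<delta> by simp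
    also have "\<dots> \<le> 9 / 8" using exp_bound[of "1 / 64"] by (simp add: power2_eq_square)
    finally have "(\<Sum>x\<in>S. (Q x + (1 - \<epsilon>) * (tri 0 1 x - tri 0 (1 - \<delta>) x))\<^sup>2 / Q x) ^ p \<le> 9 / 8" .
    moreover have single: "(\<Sum>j\<in>{1}. g j) = g 1" for g :: "nat \<Rightarrow> real" by simp
    ultimately show "(\<Sum>j\<in>{1 :: nat}. \<Sum>j'\<in>{1 :: nat}. \<Prod>i\<in>{1..p}. \<Sum>a\<in>signs. \<Sum>a'\<in>signs.
        r a * r a' * (\<Sum>x\<in>S. h a x * h a' x / Q x) ^ min j j') \<le> 9 / 8 * (real (card {1 :: nat}))\<^sup>2"
      unfolding single using G by (simp del: sum.insert insert_iff)
  qed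
qed

section \<open>Choice of constants and combination of the regimes\<close>

theorem theorem3:
  shows "\<exists>c::real. c \<ge> 1 \<and>
    (\<forall>\<alpha>::real. 0 < \<alpha> \<and> \<alpha> \<le> 2 \<longrightarrow>
      (\<exists>K\<^sub>\<alpha>::real. K\<^sub>\<alpha> > 0 \<and>
        (\<forall>K::real. K \<ge> K\<^sub>\<alpha> \<longrightarrow>
          (\<exists>c'::real. c' > 0 \<and>
            (\<forall>(n::nat) (p::nat) (s::nat) (\<rho>::real).
               n \<ge> 2 \<longrightarrow> p \<ge> 1 \<longrightarrow> s \<in> {1..p} \<longrightarrow> real s \<ge> c \<longrightarrow>
               \<rho>\<^sup>2 \<le> c' * v_lower \<alpha> p n s \<longrightarrow>
               minimax_error \<alpha> K p n s \<rho> \<ge> 1 / 2)))))"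
proof (rule exI[of _ "512::real"], intro conjI allI impI)
  fix \<alpha> :: real assume \<alpha>: "0 < \<alpha> \<and> \<alpha> \<le> 2"
  show "\<exists>K\<^sub>\<alpha>::real. K\<^sub>\<alpha> > 0 \<and>
        (\<forall>K::real. K \<ge> K\<^sub>\<alpha> \<longrightarrow>
          (\<exists>c'::real. c' > 0 \<and>
            (\<forall>(n::nat) (p::nat) (s::nat) (\<rho>::real).
               n \<ge> 2 \<longrightarrow> p \<ge> 1 \<longrightarrow> s \<in> {1..p} \<longrightarrow> real s \<ge> 512 \<longrightarrow>
               \<rho>\<^sup>2 \<le> c' * v_lower \<alpha> p n s \<longrightarrow>
               minimax_error \<alpha> K p n s \<rho> \<ge> 1 / 2)))"
  \<comment> \<open>The least \<open>K\<close> with \<open>(3 / K) powr \<alpha> <= 1/4\<close>, the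
    tail condition common to all three regimes.\<close>
  proof (rule exI[of _ "3 * 4 powr (1 / \<alpha>)"], intro conjI allI impI)
    fix K :: real assume K: "3 * 4 powr (1 / \<alpha>) \<le> K"
    have "0 < 3 * 4 powr (1 / \<alpha>)" by simp
    then have K0: "0 < K" using K by linarith
    have "3 / K \<le> 3 / (3 * 4 powr (1 / \<alpha>))" using K K0 by (intro divide_left_mono) auto
    also have "\<dots> = 4 powr (- (1 / \<alpha>))" by (simp add: powr_minus field_simps)
    finally have "(3 / K) powr \<alpha> \<le> (4 powr (- (1 / \<alpha>))) powr \<alpha>"
      using \<alpha> K0 by (intro powr_mono2) auto
    also have "\<dots> = 1 / 4" using \<alpha> by (simp only: powr_powr) (simp add: powr_minus_divide)
    finally have K': "(3 / K) powr \<alpha> \<le> 1 / 4" .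
    show "\<exists>c'::real. c' > 0 \<and>
            (\<forall>(n::nat) (p::nat) (s::nat) (\<rho>::real).
               n \<ge> 2 \<longrightarrow> p \<ge> 1 \<longrightarrow> s \<in> {1..p} \<longrightarrow> real s \<ge> 512 \<longrightarrow>
               \<rho>\<^sup>2 \<le> c' * v_lower \<alpha> p n s \<longrightarrow>
               minimax_error \<alpha> K p n s \<rho> \<ge> 1 / 2)"
    \<comment> \<open>The larger summand of \<open>v_lower\<close> is at least half of it, and
      2/2500 lies below 1/1152, 1/256 and 1/128.\<close>
    proof (rule exI[of _ "1 / 2500"], intro conjI allI impI)
      fix n p s :: nat and \<rho> :: real
      assume n: "2 \<le> n" and p: "1 \<le> p" and "s \<in> {1..p}" "512 \<le> real s"
        and \<rho>: "\<rho>\<^sup>2 \<le> 1 / 2500 * v_lower \<alpha> p n s"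
      then have s: "512 \<le> s" "s \<le> p" by auto
      define L where "L = ln (ln (8 * real n))"
      define m where "m = min (real s * ln (exp 1 * real p / real s) powr (2 / \<alpha>))
         (sqrt (real p * L ^ omega1 p n s))"
      have v: "v_lower \<alpha> p n s = m + L" by (simp add: v_lower_def m_def L_def)
      have L: "0 \<le> L" using ln_ln_ge_0[OF n] by (simp add: L_def)
      have "omega1 p n s = 1 \<or> omega1 p n s = 0" by (simp add: omega1_def)
      \<comment> \<open>The dominating summand of \<open>v_lower\<close>, and then the presence of
        the iterated logarithm, selects the regime.\<close>
      then consider "m \<le> L" | "L \<le> m" "omega1 p n s = 1" | "L \<le> m" "omega1 p n s = 0"
        using linorder_linear[of m L] by metis
      then show "1 / 2 \<le> minimax_error \<alpha> K p n s \<rho>"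
      proof cases
        case 1
        then have "\<rho>\<^sup>2 \<le> L / 1152" using \<rho> L unfolding v by (simp add: field_simps)
        then show ?thesis
          using \<alpha> K0 K' n p s unfolding L_def by (intro minimax_loglog) auto
      next
        case 2
        have m: "m \<le> sqrt (real p * L)" unfolding m_def using 2(2) by simp
        have "\<rho>\<^sup>2 \<le> sqrt (real p * L) / 256" using \<rho> L m 2(1) unfolding v by (simp add: field_simps)
        moreover have "sqrt (real p * L) \<le> real s"
          using 2(2) by (simp add: omega1_def L_def split: if_splits)
        ultimately show ?thesis
          using \<alpha> K0 K' n s unfolding L_def by (intro minimax_dense) auto
      next
        case 3
        then have "\<rho>\<^sup>2 \<le> m / 128" using \<rho> L unfolding v by (simp add: field_simps)
        then show ?thesis
          using \<alpha> K0 K' n s 3(2) unfolding m_def by (intro minimax_sparse) auto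
      qed
    qed simp
  qed simp
qed simp

end
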